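(* Let $X,Y$ be based topological spaces and $n\geq1$. (1) If $[f]\leqq_R[g]$, then $G_n(Y,X;g)\subset G_n(Y,X;f)$, i.e. $\mathfrak{g}_n([g])\leqq\mathfrak{g}_n([f])$. Hence $\mathfrak{g}_n:([X,Y],\leqq_R^{op})\to(\mathcal{S}ub(\pi_n(Y)),\leqq)$ is a monotone map. (2) If $[f]_R\leqq'_R[g]_R$, then $G_n(Y,X;g)\subset G_n(Y,X;f)$, i.e. $\mathfrak{g}_n^R([g]_R)\leqq\mathfrak{g}_n^R([f]_R)$. Hence $\mathfrak{g}_n^R:([X,Y]_R,\leqq_R'^{\,op})\to(\mathcal{S}ub(\pi_n(Y)),\leqq)$ is a monotone map. Moreover $\mathfrak{g}_n^R\circ\pi_R=\mathfrak{g}_n$, where $\pi_R:([X,Y],\leqq_R^{op})\to([X,Y]_R,\leqq_R'^{\,op})$ is the map $[f]\mapsto[f]_R$.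
   Context: Spaces are based, maps and homotopies are based, and $[X,Y]$ denotes the set of based homotopy classes of based maps $X\to Y$. The preorder $\leqq_R$ on $[X,Y]$: $[f]\leqq_R[g]$ iff there is $[s]\in[X,X]$ with $[f]=[g]\circ[s]$. $[f]\sim_R[g]$ iff $[f]\leqq_R[g]$ and $[g]\leqq_R[f]$; $[X,Y]_R=[X,Y]/\sim_R$ with classes $[f]_R$, partially ordered by $[f]_R\leqq'_R[g]_R$ iff $[f]\leqq_R[g]$. For a preorder $\leqq$, $a\leqq^{op}b$ means $b\leqq a$. For a group $G$, $\mathcal{S}ub(G)$ is the set of subgroups ordered by inclusion. For a based map $f:X\to Y$, $Map(X,Y;f)$ is the path component of $f$ in the space $Map(X,Y)$ of (not necessarily based) continuous maps, $ev:Map(X,Y;f)\to Y$, $ev(g)=g( * )$, is evaluation at the base point $*$ of $X$, and the $n$-th evaluation subgroup is $G_n(Y,X;f):=\operatorname{Im}(ev_*:\pi_n(Map(X,Y;f),f)\to\pi_n(Y))$. It depends only on the class of $f$ in $[X,Y]$ and indeed only on $[f]_R$; $\mathfrak{g}_n([f]):=G_n(Y,X;f)$ and $\mathfrak{g}_n^R([f]_R):=G_n(Y,X;f)$. *)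

theory Defs
  imports "HOL-Analysis.Analysis" "HOL-Algebra.Group"
begin

section \<open>Homotopy classes of maps of pairs into a based space\<close>

text \<open>
  Maps between topologies are represented by their extensional representatives, so that equality
  of HOL functions is equality of maps. Based maps are the case \<open>S = {x0}\<close>; maps
  of a cube that are constant on its boundary give the homotopy groups.
\<close>

definition pair_maps :: "'a topology \<Rightarrow> 'a set \<Rightarrow> 'b topology \<Rightarrow> 'b \<Rightarrow> ('a \<Rightarrow> 'b) set" where
  "pair_maps X S Y y0 =
     {f \<in> extensional (topspace X). continuous_map X Y f \<and> f ` S \<subseteq> {y0}}"

definition pair_homotopy :: "'a topology \<Rightarrow> 'a set \<Rightarrow> 'b topology \<Rightarrow> 'b \<Rightarrow> ('a \<Rightarrow> 'b) rel" where
  "pair_homotopy X S Y y0 =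
     {(f, g). f \<in> pair_maps X S Y y0 \<and> g \<in> pair_maps X S Y y0 \<and>
              homotopic_with (\<lambda>h. h ` S \<subseteq> {y0}) X Y f g}"

definition pair_class ::
    "'a topology \<Rightarrow> 'a set \<Rightarrow> 'b topology \<Rightarrow> 'b \<Rightarrow> ('a \<Rightarrow> 'b) \<Rightarrow> ('a \<Rightarrow> 'b) set" where
  "pair_class X S Y y0 f = pair_homotopy X S Y y0 `` {f}"

definition pair_classes ::
    "'a topology \<Rightarrow> 'a set \<Rightarrow> 'b topology \<Rightarrow> 'b \<Rightarrow> ('a \<Rightarrow> 'b) set set" where
  "pair_classes X S Y y0 = pair_maps X S Y y0 // pair_homotopy X S Y y0"

lemma equiv_pair_homotopy: "equiv (pair_maps X S Y y0) (pair_homotopy X S Y y0)"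
proof (rule equivI)
  show "refl_on (pair_maps X S Y y0) (pair_homotopy X S Y y0)"
    by (auto simp: refl_on_def pair_homotopy_def pair_maps_def)
  show "sym (pair_homotopy X S Y y0)"
    by (auto simp: sym_def pair_homotopy_def intro: homotopic_with_symD)
  show "trans (pair_homotopy X S Y y0)"
    by (auto simp: trans_def pair_homotopy_def intro: homotopic_with_trans)
qed (auto simp: pair_homotopy_def)


section \<open>Based homotopy classes and the preorder \<open>\<le>\<^sub>R\<close>\<close>

abbreviation based_maps :: "'a topology \<Rightarrow> 'a \<Rightarrow> 'b topology \<Rightarrow> 'b \<Rightarrow> ('a \<Rightarrow> 'b) set" where
  "based_maps X x0 \<equiv> pair_maps X {x0}"

abbreviation based_class ::
    "'a topology \<Rightarrow> 'a \<Rightarrow> 'b topology \<Rightarrow> 'b \<Rightarrow> ('a \<Rightarrow> 'b) \<Rightarrow> ('a \<Rightarrow> 'b) set" where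
  "based_class X x0 \<equiv> pair_class X {x0}"

abbreviation based_classes ::
    "'a topology \<Rightarrow> 'a \<Rightarrow> 'b topology \<Rightarrow> 'b \<Rightarrow> ('a \<Rightarrow> 'b) set set" where
  "based_classes X x0 \<equiv> pair_classes X {x0}"

text \<open>Composition \<open>[X,Y] \<times> [X,X] \<rightarrow> [X,Y]\<close>, that is \<open>[g] \<circ> [s] = [g \<circ> s]\<close>
  (see \<open>class_comp_class\<close> below).\<close>

definition class_comp ::
    "'a topology \<Rightarrow> 'a \<Rightarrow> 'b topology \<Rightarrow> 'b \<Rightarrow> ('a \<Rightarrow> 'b) set \<Rightarrow> ('a \<Rightarrow> 'a) set \<Rightarrow> ('a \<Rightarrow> 'b) set" where
  "class_comp X x0 Y y0 b c =
     (\<Union>g\<in>b. \<Union>s\<in>c. based_class X x0 Y y0 (compose (topspace X) g s))"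

definition leR ::
    "'a topology \<Rightarrow> 'a \<Rightarrow> 'b topology \<Rightarrow> 'b \<Rightarrow> ('a \<Rightarrow> 'b) set \<Rightarrow> ('a \<Rightarrow> 'b) set \<Rightarrow> bool" where
  "leR X x0 Y y0 a b \<longleftrightarrow>
     a \<in> based_classes X x0 Y y0 \<and> b \<in> based_classes X x0 Y y0 \<and>
     (\<exists>c \<in> based_classes X x0 X x0. a = class_comp X x0 Y y0 b c)"

definition simR ::
    "'a topology \<Rightarrow> 'a \<Rightarrow> 'b topology \<Rightarrow> 'b \<Rightarrow> ('a \<Rightarrow> 'b) set rel" where
  "simR X x0 Y y0 = {(a, b). leR X x0 Y y0 a b \<and> leR X x0 Y y0 b a}"

definition based_classesR ::
    "'a topology \<Rightarrow> 'a \<Rightarrow> 'b topology \<Rightarrow> 'b \<Rightarrow> ('a \<Rightarrow> 'b) set set set" where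
  "based_classesR X x0 Y y0 = based_classes X x0 Y y0 // simR X x0 Y y0"

definition projR ::
    "'a topology \<Rightarrow> 'a \<Rightarrow> 'b topology \<Rightarrow> 'b \<Rightarrow> ('a \<Rightarrow> 'b) set \<Rightarrow> ('a \<Rightarrow> 'b) set set" where
  "projR X x0 Y y0 a = simR X x0 Y y0 `` {a}"

definition leR' ::
    "'a topology \<Rightarrow> 'a \<Rightarrow> 'b topology \<Rightarrow> 'b \<Rightarrow> ('a \<Rightarrow> 'b) set set \<Rightarrow> ('a \<Rightarrow> 'b) set set \<Rightarrow> bool" where
  "leR' X x0 Y y0 A B \<longleftrightarrow>
     A \<in> based_classesR X x0 Y y0 \<and> B \<in> based_classesR X x0 Y y0 \<and>
     (\<exists>a\<in>A. \<exists>b\<in>B. leR X x0 Y y0 a b)"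

lemma based_compose:
  assumes "g \<in> based_maps X x0 Y y0" "s \<in> based_maps X x0 X x0" "x0 \<in> topspace X"
  shows "compose (topspace X) g s \<in> based_maps X x0 Y y0"
proof -
  have "continuous_map X Y (g \<circ> s)"
    using assms by (auto simp: pair_maps_def intro: continuous_map_compose)
  then have "continuous_map X Y (compose (topspace X) g s)"
    by (rule continuous_map_eq) (auto simp: compose_def)
  then show ?thesis
    using assms by (auto simp: pair_maps_def compose_def)
qed

lemma homotopic_compose:
  assumes "(g, g') \<in> pair_homotopy X {x0} Y y0" "(s, s') \<in> pair_homotopy X {x0} X x0"
    and "x0 \<in> topspace X"
  shows "(compose (topspace X) g s, compose (topspace X) g' s') \<in> pair_homotopy X {x0} Y y0"
proof -
  have maps: "g \<in> based_maps X x0 Y y0" "g' \<in> based_maps X x0 Y y0"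
      "s \<in> based_maps X x0 X x0" "s' \<in> based_maps X x0 X x0"
    using assms by (auto simp: pair_homotopy_def)
  have c: "compose (topspace X) g s \<in> based_maps X x0 Y y0"
      "compose (topspace X) g' s' \<in> based_maps X x0 Y y0"
    using based_compose[OF maps(1,3) assms(3)] based_compose[OF maps(2,4) assms(3)] by auto
  let ?P = "\<lambda>h. h ` {x0} \<subseteq> {y0}"
  have "homotopic_with ?P X Y (g \<circ> s) (g \<circ> s')"
    by (rule homotopic_with_compose_continuous_map_left[where p="\<lambda>h. h ` {x0} \<subseteq> {x0}"])
      (use assms maps(1) in \<open>auto simp: pair_homotopy_def pair_maps_def\<close>)
  moreover have "homotopic_with ?P X Y (g \<circ> s') (g' \<circ> s')"
    by (rule homotopic_with_compose_continuous_map_right[where p="?P"])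
      (use assms maps(4) in \<open>auto simp: pair_homotopy_def pair_maps_def\<close>)
  ultimately have hgs: "homotopic_with ?P X Y (g \<circ> s) (g' \<circ> s')"
    by (rule homotopic_with_trans)
  have e: "homotopic_with ?P X Y (compose (topspace X) k t) (k \<circ> t)"
    if "compose (topspace X) k t \<in> based_maps X x0 Y y0" for k t
    using that assms(3)
    by (intro homotopic_with_equal) (auto simp: pair_maps_def compose_def)
  have "homotopic_with ?P X Y (compose (topspace X) g s) (compose (topspace X) g' s')"
    using e[OF c(1)] hgs e[OF c(2)] by (meson homotopic_with_trans homotopic_with_symD)
  then show ?thesis
    using c by (simp add: pair_homotopy_def)
qed

lemma class_comp_class:
  assumes "g \<in> based_maps X x0 Y y0" "s \<in> based_maps X x0 X x0" "x0 \<in> topspace X"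
  shows "class_comp X x0 Y y0 (based_class X x0 Y y0 g) (based_class X x0 X x0 s) =
         based_class X x0 Y y0 (compose (topspace X) g s)"
proof -
  have "based_class X x0 Y y0 (compose (topspace X) g' s') =
        based_class X x0 Y y0 (compose (topspace X) g s)"
    if "g' \<in> based_class X x0 Y y0 g" "s' \<in> based_class X x0 X x0 s" for g' s'
    using homotopic_compose[of g g' X x0 Y y0 s s'] that assms(3)
    by (auto simp: pair_class_def intro!: equiv_class_eq[OF equiv_pair_homotopy, symmetric])
  moreover have "g \<in> based_class X x0 Y y0 g" "s \<in> based_class X x0 X x0 s"
    using assms equiv_class_self[OF equiv_pair_homotopy] by (auto simp: pair_class_def)
  ultimately show ?thesis
    unfolding class_comp_def by blast
qed

lemma leR_class_iff:
  assumes "f \<in> based_maps X x0 Y y0" "g \<in> based_maps X x0 Y y0" "x0 \<in> topspace X"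
  shows "leR X x0 Y y0 (based_class X x0 Y y0 f) (based_class X x0 Y y0 g) \<longleftrightarrow>
         (\<exists>s \<in> based_maps X x0 X x0.
            homotopic_with (\<lambda>h. h ` {x0} \<subseteq> {y0}) X Y f (compose (topspace X) g s))"
proof -
  have cl: "based_class X x0 Y y0 k \<in> based_classes X x0 Y y0"
    if "k \<in> based_maps X x0 Y y0" for k
    using that by (auto simp: pair_class_def pair_classes_def intro: quotientI)
  have "leR X x0 Y y0 (based_class X x0 Y y0 f) (based_class X x0 Y y0 g) \<longleftrightarrow>
      (\<exists>s \<in> based_maps X x0 X x0. based_class X x0 Y y0 f =
         class_comp X x0 Y y0 (based_class X x0 Y y0 g) (based_class X x0 X x0 s))"
    using cl assms(1,2)
    by (auto simp: leR_def pair_classes_def quotient_def pair_class_def)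
  also have "\<dots> \<longleftrightarrow> (\<exists>s \<in> based_maps X x0 X x0.
      (f, compose (topspace X) g s) \<in> pair_homotopy X {x0} Y y0)"
    using assms based_compose[OF assms(2) _ assms(3)]
    by (intro bex_cong refl)
      (simp only: class_comp_class, simp add: pair_class_def eq_equiv_class_iff[OF equiv_pair_homotopy])
  also have "\<dots> \<longleftrightarrow> (\<exists>s \<in> based_maps X x0 X x0.
      homotopic_with (\<lambda>h. h ` {x0} \<subseteq> {y0}) X Y f (compose (topspace X) g s))"
    using assms based_compose[OF assms(2) _ assms(3)] by (auto simp: pair_homotopy_def)
  finally show ?thesis .
qed

lemma based_classesE:
  assumes "a \<in> based_classes X x0 Y y0"
  obtains f where "f \<in> based_maps X x0 Y y0" "a = based_class X x0 Y y0 f"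
  using assms by (auto simp: pair_classes_def pair_class_def quotient_def)

lemma leR_refl:
  assumes "x0 \<in> topspace X" "a \<in> based_classes X x0 Y y0"
  shows "leR X x0 Y y0 a a"
proof -
  obtain f where f: "f \<in> based_maps X x0 Y y0" "a = based_class X x0 Y y0 f"
    using assms(2) by (rule based_classesE)
  let ?i = "restrict id (topspace X)"
  have i: "?i \<in> based_maps X x0 X x0"
    using assms(1) by (auto simp: pair_maps_def)
  have "compose (topspace X) f ?i = f"
    using f(1) by (auto simp: compose_def fun_eq_iff pair_maps_def extensional_def)
  moreover have "homotopic_with (\<lambda>h. h ` {x0} \<subseteq> {y0}) X Y f f"
    using f(1) by (simp add: pair_maps_def)
  ultimately show ?thesis
    using f i assms(1) by (metis leR_class_iff)
qed

lemma leR_trans: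
  assumes "x0 \<in> topspace X" "leR X x0 Y y0 a b" "leR X x0 Y y0 b c"
  shows "leR X x0 Y y0 a c"
proof -
  obtain f g h where fgh: "f \<in> based_maps X x0 Y y0" "a = based_class X x0 Y y0 f"
      "g \<in> based_maps X x0 Y y0" "b = based_class X x0 Y y0 g"
      "h \<in> based_maps X x0 Y y0" "c = based_class X x0 Y y0 h"
    using assms(2,3) by (meson based_classesE leR_def)
  let ?P = "\<lambda>h. h ` {x0} \<subseteq> {y0}"
  obtain s t where s: "s \<in> based_maps X x0 X x0"
      "homotopic_with ?P X Y f (compose (topspace X) g s)"
    and t: "t \<in> based_maps X x0 X x0" "homotopic_with ?P X Y g (compose (topspace X) h t)"
    using assms fgh by (auto simp: leR_class_iff)
  have "(g, compose (topspace X) h t) \<in> pair_homotopy X {x0} Y y0"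
       "(s, s) \<in> pair_homotopy X {x0} X x0"
    using t s fgh based_compose[OF fgh(5) t(1) assms(1)]
    by (auto simp: pair_homotopy_def pair_maps_def)
  from homotopic_compose[OF this assms(1)]
  have "homotopic_with ?P X Y (compose (topspace X) g s)
          (compose (topspace X) (compose (topspace X) h t) s)"
    by (simp add: pair_homotopy_def)
  moreover have "s \<in> topspace X \<rightarrow> topspace X"
    using s(1) by (auto simp: pair_maps_def continuous_map_def)
  then have "compose (topspace X) (compose (topspace X) h t) s =
      compose (topspace X) h (compose (topspace X) t s)"
    by (rule compose_assoc[symmetric])
  ultimately have "homotopic_with ?P X Y f (compose (topspace X) h (compose (topspace X) t s))"
    using s(2) by (metis homotopic_with_trans)
  moreover have "compose (topspace X) t s \<in> based_maps X x0 X x0"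
    by (rule based_compose[OF t(1) s(1) assms(1)])
  ultimately show ?thesis
    using fgh assms(1) by (auto simp: leR_class_iff)
qed

lemma equiv_simR:
  assumes "x0 \<in> topspace X"
  shows "equiv (based_classes X x0 Y y0) (simR X x0 Y y0)"
proof (rule equivI)
  show "refl_on (based_classes X x0 Y y0) (simR X x0 Y y0)"
    using leR_refl[OF assms] by (auto simp: refl_on_def simR_def)
  show "trans (simR X x0 Y y0)"
  proof (rule transI)
    fix a b c
    assume "(a, b) \<in> simR X x0 Y y0" "(b, c) \<in> simR X x0 Y y0"
    then show "(a, c) \<in> simR X x0 Y y0"
      using leR_trans[OF assms, of Y y0 a b c] leR_trans[OF assms, of Y y0 c b a]
      by (simp add: simR_def)
  qed
qed (auto simp: simR_def leR_def sym_def)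

lemma leR'_projR_iff:
  assumes "x0 \<in> topspace X" "a \<in> based_classes X x0 Y y0" "b \<in> based_classes X x0 Y y0"
  shows "leR' X x0 Y y0 (projR X x0 Y y0 a) (projR X x0 Y y0 b) \<longleftrightarrow> leR X x0 Y y0 a b"
proof
  assume "leR' X x0 Y y0 (projR X x0 Y y0 a) (projR X x0 Y y0 b)"
  then obtain a' b' where ab: "leR X x0 Y y0 a a'" "leR X x0 Y y0 a' b'" "leR X x0 Y y0 b' b"
    by (auto simp: leR'_def projR_def simR_def)
  show "leR X x0 Y y0 a b"
    by (rule leR_trans[OF assms(1) leR_trans[OF assms(1) ab(1,2)] ab(3)])
next
  assume "leR X x0 Y y0 a b"
  moreover have "a \<in> projR X x0 Y y0 a" "b \<in> projR X x0 Y y0 b"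
    using leR_refl[OF assms(1,2)] leR_refl[OF assms(1,3)] by (auto simp: projR_def simR_def)
  ultimately show "leR' X x0 Y y0 (projR X x0 Y y0 a) (projR X x0 Y y0 b)"
    using assms by (auto simp: leR'_def projR_def based_classesR_def intro: quotientI)
qed

lemma leR'_order:
  assumes "x0 \<in> topspace X"
  shows "reflp_on (based_classesR X x0 Y y0) (leR' X x0 Y y0)"
    and "antisymp_on (based_classesR X x0 Y y0) (leR' X x0 Y y0)"
    and "transp_on (based_classesR X x0 Y y0) (leR' X x0 Y y0)"
proof -
  have ex: "\<exists>a. a \<in> based_classes X x0 Y y0 \<and> A = projR X x0 Y y0 a"
    if "A \<in> based_classesR X x0 Y y0" for A
    using that by (auto simp: based_classesR_def projR_def quotient_def)
  show "reflp_on (based_classesR X x0 Y y0) (leR' X x0 Y y0)"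
    by (rule reflp_onI) (metis ex leR'_projR_iff[OF assms] leR_refl[OF assms])
  show "transp_on (based_classesR X x0 Y y0) (leR' X x0 Y y0)"
    proof (rule transp_onI)
    fix A B C
    assume "A \<in> based_classesR X x0 Y y0" "B \<in> based_classesR X x0 Y y0"
        "C \<in> based_classesR X x0 Y y0"
      and le: "leR' X x0 Y y0 A B" "leR' X x0 Y y0 B C"
    then obtain a b c where abc: "a \<in> based_classes X x0 Y y0" "b \<in> based_classes X x0 Y y0"
        "c \<in> based_classes X x0 Y y0"
      and eq: "A = projR X x0 Y y0 a" "B = projR X x0 Y y0 b" "C = projR X x0 Y y0 c"
      using ex by meson
    have "leR X x0 Y y0 a b" "leR X x0 Y y0 b c"
      using le abc by (simp_all add: eq leR'_projR_iff[OF assms])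
    then have "leR X x0 Y y0 a c"
      by (rule leR_trans[OF assms])
    then show "leR' X x0 Y y0 A C"
      using abc by (simp add: eq leR'_projR_iff[OF assms])
  qed
  show "antisymp_on (based_classesR X x0 Y y0) (leR' X x0 Y y0)"
  proof (rule antisymp_onI)
    fix A B
    assume AB: "A \<in> based_classesR X x0 Y y0" "B \<in> based_classesR X x0 Y y0"
      and le: "leR' X x0 Y y0 A B" "leR' X x0 Y y0 B A"
    obtain a b where ab: "a \<in> based_classes X x0 Y y0" "A = projR X x0 Y y0 a"
        "b \<in> based_classes X x0 Y y0" "B = projR X x0 Y y0 b"
      using ex AB by meson
    then have "(a, b) \<in> simR X x0 Y y0"
      using le leR'_projR_iff[OF assms ab(1,3)] leR'_projR_iff[OF assms ab(3,1)]
      by (simp add: simR_def)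
    then show "A = B"
      using ab equiv_class_eq[OF equiv_simR[OF assms]] by (simp add: projR_def)
  qed
qed


section \<open>Homotopy groups\<close>

definition cube :: "nat \<Rightarrow> (nat \<Rightarrow> real) topology" where
  "cube n = product_topology (\<lambda>_. top_of_set {0..1}) {..<n}"

definition cube_boundary :: "nat \<Rightarrow> (nat \<Rightarrow> real) set" where
  "cube_boundary n = {x \<in> topspace (cube n). \<exists>i<n. x i = 0 \<or> x i = 1}"

definition cube_concat ::
    "nat \<Rightarrow> ((nat \<Rightarrow> real) \<Rightarrow> 'a) \<Rightarrow> ((nat \<Rightarrow> real) \<Rightarrow> 'a) \<Rightarrow> (nat \<Rightarrow> real) \<Rightarrow> 'a" where
  "cube_concat n \<alpha> \<beta> =
     (\<lambda>x \<in> topspace (cube n). if x 0 \<le> 1/2 then \<alpha> (x(0 := 2 * x 0)) else \<beta> (x(0 := 2 * x 0 - 1)))"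

abbreviation cube_class ::
    "nat \<Rightarrow> 'a topology \<Rightarrow> 'a \<Rightarrow> ((nat \<Rightarrow> real) \<Rightarrow> 'a) \<Rightarrow> ((nat \<Rightarrow> real) \<Rightarrow> 'a) set" where
  "cube_class n \<equiv> pair_class (cube n) (cube_boundary n)"

text \<open>The group \<open>\<pi>\<^sub>n(X, x0)\<close>, multiplied by concatenation in coordinate \<open>0\<close>; only
  \<open>n \<ge> 1\<close> is meaningful.\<close>

definition homotopy_group ::
    "nat \<Rightarrow> 'a topology \<Rightarrow> 'a \<Rightarrow> ((nat \<Rightarrow> real) \<Rightarrow> 'a) set monoid" where
  "homotopy_group n X x0 =
     \<lparr>carrier = pair_classes (cube n) (cube_boundary n) X x0,
      mult = (\<lambda>a b. \<Union>\<alpha>\<in>a. \<Union>\<beta>\<in>b. cube_class n X x0 (cube_concat n \<alpha> \<beta>)),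
      one = cube_class n X x0 (\<lambda>x \<in> topspace (cube n). x0)\<rparr>"

text \<open>The map \<open>\<pi>\<^sub>n(X, x0) \<rightarrow> \<pi>\<^sub>n(Y, h x0)\<close> induced by a continuous \<open>h : X \<rightarrow> Y\<close>.\<close>

definition induced_map ::
    "nat \<Rightarrow> 'a \<Rightarrow> 'b topology \<Rightarrow> ('a \<Rightarrow> 'b)
     \<Rightarrow> ((nat \<Rightarrow> real) \<Rightarrow> 'a) set \<Rightarrow> ((nat \<Rightarrow> real) \<Rightarrow> 'b) set" where
  "induced_map n x0 Y h a =
     (\<Union>\<alpha>\<in>a. cube_class n Y (h x0) (compose (topspace (cube n)) h \<alpha>))"

definition Sub :: "('a, 'b) monoid_scheme \<Rightarrow> 'a set set" where
  "Sub G = {H. subgroup H G}"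


section \<open>Mapping spaces and evaluation subgroups\<close>

text \<open>The space of all (not necessarily based) continuous maps with the compact-open topology.\<close>

definition mapping_space :: "'a topology \<Rightarrow> 'b topology \<Rightarrow> ('a \<Rightarrow> 'b) topology" where
  "mapping_space X Y = topology_generated_by
     {{f \<in> extensional (topspace X). continuous_map X Y f \<and> f ` K \<subseteq> U} | K U.
        compactin X K \<and> openin Y U}"

lemma topspace_mapping_space:
  "topspace (mapping_space X Y) = {f \<in> extensional (topspace X). continuous_map X Y f}"
  unfolding mapping_space_def topology_generated_by_topspace
  by (auto intro!: exI[of _ "{}"])

definition mapping_component ::
    "'a topology \<Rightarrow> 'b topology \<Rightarrow> ('a \<Rightarrow> 'b) \<Rightarrow> ('a \<Rightarrow> 'b) topology" where
  "mapping_component X Y f =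
     subtopology (mapping_space X Y) (path_component_of_set (mapping_space X Y) f)"

text \<open>\<open>G\<^sub>n(Y, X; f)\<close> as a subset of \<open>\<pi>\<^sub>n(Y, f x0)\<close>, where \<open>x0\<close> is the base point of \<open>X\<close>.\<close>

definition evaluation_subgroup ::
    "nat \<Rightarrow> 'b topology \<Rightarrow> 'a topology \<Rightarrow> 'a \<Rightarrow> ('a \<Rightarrow> 'b) \<Rightarrow> ((nat \<Rightarrow> real) \<Rightarrow> 'b) set set" where
  "evaluation_subgroup n Y X x0 f =
     induced_map n f Y (\<lambda>g. g x0) ` carrier (homotopy_group n (mapping_component X Y f) f)"

text \<open>
  The functions induced on \<open>[X,Y]\<close> and on \<open>[X,Y]\<^sub>R\<close>: the common value on
  the representatives of the class.
\<close>

definition ev_class ::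
    "nat \<Rightarrow> 'b topology \<Rightarrow> 'a topology \<Rightarrow> 'a \<Rightarrow> ('a \<Rightarrow> 'b) set \<Rightarrow> ((nat \<Rightarrow> real) \<Rightarrow> 'b) set set" where
  "ev_class n Y X x0 a = the_elem (evaluation_subgroup n Y X x0 ` a)"

definition ev_classR ::
    "nat \<Rightarrow> 'b topology \<Rightarrow> 'a topology \<Rightarrow> 'a \<Rightarrow> ('a \<Rightarrow> 'b) set set \<Rightarrow> ((nat \<Rightarrow> real) \<Rightarrow> 'b) set set" where
  "ev_classR n Y X x0 A = the_elem (ev_class n Y X x0 ` A)"

end

theory Submission
  imports Defs
begin

text \<open>
  An element of \<open>G\<^sub>n(Y, X; g)\<close> is the class of an evaluated cube \<open>t \<mapsto> \<alpha>(t)(x0)\<close>, where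
  \<open>\<alpha>\<close> is an \<open>n\<close>-cube in the space of all maps \<open>X \<rightarrow> Y\<close> that is constantly \<open>g\<close> on the boundary.

  Let \<open>[f] = [g] \<circ> [s]\<close>. Precomposing every \<open>\<alpha>(t)\<close> with \<open>s\<close> gives a cube of maps with
  boundary value \<open>g \<circ> s\<close>, and since \<open>s(x0) = x0\<close> its evaluation is literally the evaluation of
  \<open>\<alpha>\<close>. Hence \<open>G\<^sub>n(Y, X; g) \<subseteq> G\<^sub>n(Y, X; g \<circ> s)\<close> (\<open>evaluation_subgroup_precompose\<close>). What remains is
  to replace \<open>g \<circ> s\<close> by the map \<open>f\<close> that is homotopic to it through based maps. Such a homotopy is
  a path \<open>\<gamma>\<close> in the mapping space, and the usual change of base point shrinks a cube based at one end
  of \<open>\<gamma>\<close> to the concentric subcube of half the side length and fills the surrounding shell with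
  \<open>\<gamma>\<close>. Because \<open>\<gamma>\<close> runs through based maps, its evaluation at \<open>x0\<close> is constantly \<open>y0\<close>; the
  evaluated new cube is therefore only a reparametrization of the evaluated old one and has the same class
  (\<open>base_point_change\<close>, \<open>evaluation_subgroup_homotopic_subset\<close>).

  Only the easy direction of the exponential law enters: a homotopy \<open>I \<times> X \<rightarrow> Y\<close> is a continuous path
  for the compact-open topology. This holds for an arbitrary \<open>X\<close>, so all cubes are manipulated
  inside the mapping space and are never turned back into maps \<open>I\<^sup>n \<times> X \<rightarrow> Y\<close>.

  The values lie in \<open>Sub(\<pi>\<^sub>n(Y))\<close> because evaluation commutes on the nose with concatenation and reversal of
  cubes. Inverses in \<open>\<pi>\<^sub>n(Y)\<close> make sense only once \<open>\<pi>\<^sub>n(Y)\<close> is known to be a group;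
  each group law compares one cube with a reparametrization of itself in
  coordinate \<open>0\<close>, and any two reparametrizations that agree in a suitable way on the boundary are joined by a
  straight line. The same principle gives the homotopy in the change of base point.
\<close>

section \<open>Homotopies of maps of pairs\<close>

lemma pair_homotopyD:
  assumes "(f, g) \<in> pair_homotopy X S Y y0"
  shows "f \<in> pair_maps X S Y y0" "g \<in> pair_maps X S Y y0"
    "homotopic_with (\<lambda>h. h ` S \<subseteq> {y0}) X Y f g"
  using assms by (auto simp: pair_homotopy_def)

lemma pair_homotopy_refl:
  "f \<in> pair_maps X S Y y0 \<Longrightarrow> (f, f) \<in> pair_homotopy X S Y y0"
  by (simp add: pair_homotopy_def pair_maps_def)

lemma pair_homotopy_sym:
  "(f, g) \<in> pair_homotopy X S Y y0 \<Longrightarrow> (g, f) \<in> pair_homotopy X S Y y0"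
  by (auto simp: pair_homotopy_def intro: homotopic_with_symD)

lemma pair_class_eqI:
  "(f, g) \<in> pair_homotopy X S Y y0 \<Longrightarrow> pair_class X S Y y0 f = pair_class X S Y y0 g"
  unfolding pair_class_def by (rule equiv_class_eq[OF equiv_pair_homotopy])

lemma pair_class_self: "f \<in> pair_maps X S Y y0 \<Longrightarrow> f \<in> pair_class X S Y y0 f"
  unfolding pair_class_def by (rule equiv_class_self[OF equiv_pair_homotopy])

lemma pair_classes_eq_image:
  "pair_classes X S Y y0 = pair_class X S Y y0 ` pair_maps X S Y y0"
  by (auto simp: pair_classes_def pair_class_def quotient_def)

text \<open>In \<open>homotopic_with\<close> the ends of the homotopy are prescribed at all points of the
  type. Here only the values on the topological space matter, because the property in question looks
  at \<open>S \<subseteq> topspace X\<close> only.\<close>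

lemma homotopic_with_pairI:
  assumes "continuous_map (prod_topology (top_of_set {0..1::real}) X) Y h"
    and "\<And>x. x \<in> topspace X \<Longrightarrow> h (0, x) = f x"
    and "\<And>x. x \<in> topspace X \<Longrightarrow> h (1, x) = g x"
    and "\<And>t x. t \<in> {0..1} \<Longrightarrow> x \<in> S \<Longrightarrow> h (t, x) \<in> T"
    and "S \<subseteq> topspace X"
  shows "homotopic_with (\<lambda>k. k ` S \<subseteq> T) X Y f g"
proof (subst homotopic_with)
  show "(k ` S \<subseteq> T) \<longleftrightarrow> (k' ` S \<subseteq> T)" if "\<And>x. x \<in> topspace X \<Longrightarrow> k x = k' x" for k k'
    using that assms(5) by (metis image_cong subsetD)
  show "\<exists>h. continuous_map (prod_topology (top_of_set {0..1::real}) X) Y h \<and>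
      (\<forall>x\<in>topspace X. h (0, x) = f x) \<and> (\<forall>x\<in>topspace X. h (1, x) = g x) \<and>
      (\<forall>t\<in>{0..1}. (\<lambda>x. h (t, x)) ` S \<subseteq> T)"
    by (intro exI[of _ h] conjI ballI image_subsetI assms(1-4))
qed

lemma pair_homotopyE:
  assumes "(f, g) \<in> pair_homotopy X S Y y0"
  obtains h where "continuous_map (prod_topology (top_of_set {0..1::real}) X) Y h"
    "\<And>x. h (0, x) = f x" "\<And>x. h (1, x) = g x"
    "\<And>t x. t \<in> {0..1} \<Longrightarrow> x \<in> S \<Longrightarrow> h (t, x) = y0"
proof -
  from pair_homotopyD(3)[OF assms] obtain h where h:
    "continuous_map (prod_topology (top_of_set {0..1::real}) X) Y h"
    "\<forall>x. h (0, x) = f x" "\<forall>x. h (1, x) = g x"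
    "\<forall>t\<in>{0..1}. (\<lambda>x. h (t, x)) ` S \<subseteq> {y0}"
    unfolding homotopic_with_def by blast
  show thesis
    by (rule that[OF h(1)]) (use h(2-4) in blast)+
qed

text \<open>A homotopy of the inner map, through maps of pairs, is carried along by any outer map that
  collapses the second subset. The lemma has two uses: the inner map is a reparametrization of a cube, with
  \<open>S\<close> and \<open>T\<close> both the boundary, or it is a cube in a mapping space, with \<open>T\<close> a single map, to which
  evaluation is applied.\<close>

lemma compose_pair_homotopic:
  assumes hom: "homotopic_with (\<lambda>k. k ` S \<subseteq> T) Z X \<phi> \<psi>"
    and f: "continuous_map X Y f" "f ` T \<subseteq> {y0}"
    and S: "S \<subseteq> topspace Z"
  shows "(compose (topspace Z) f \<phi>, compose (topspace Z) f \<psi>) \<in> pair_homotopy Z S Y y0"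
proof -
  have h: "homotopic_with (\<lambda>k. k ` S \<subseteq> {y0}) Z Y (f \<circ> \<phi>) (f \<circ> \<psi>)"
    by (rule homotopic_with_compose_continuous_map_left[OF hom f(1)]) (use f(2) in auto)
  have e: "homotopic_with (\<lambda>k. k ` S \<subseteq> {y0}) Z Y (compose (topspace Z) f k) (f \<circ> k)
      \<and> compose (topspace Z) f k \<in> pair_maps Z S Y y0"
    if "continuous_map Z X k" "k ` S \<subseteq> T" for k
  proof -
    have c: "continuous_map Z Y (f \<circ> k)"
      using that f by (intro continuous_map_compose)
    have c': "continuous_map Z Y (compose (topspace Z) f k)"
      by (rule continuous_map_eq[OF c]) (simp add: compose_def)
    have s: "compose (topspace Z) f k ` S \<subseteq> {y0}"
      using that f(2) S by (auto simp: compose_def)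
    moreover have "compose (topspace Z) f k \<in> pair_maps Z S Y y0"
      using c' s by (simp add: pair_maps_def)
    moreover have "(f \<circ> k) ` S \<subseteq> {y0}"
      using that(2) f(2) by auto
    moreover from s this c' have "homotopic_with (\<lambda>k. k ` S \<subseteq> {y0}) Z Y (compose (topspace Z) f k) (f \<circ> k)"
      by (rule homotopic_with_equal) (simp add: compose_def)
    ultimately show ?thesis
      by blast
  qed
  note cont = homotopic_with_imp_continuous_maps[OF hom]
  note e\<phi> = e[OF conjunct1[OF cont] conjunct1[OF homotopic_with_imp_property[OF hom]]]
    and e\<psi> = e[OF conjunct2[OF cont] conjunct2[OF homotopic_with_imp_property[OF hom]]]
  have "homotopic_with (\<lambda>k. k ` S \<subseteq> {y0}) Z Y (compose (topspace Z) f \<phi>) (compose (topspace Z) f \<psi>)"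
    using homotopic_with_trans[OF homotopic_with_trans[OF conjunct1[OF e\<phi>] h]
        homotopic_with_symD[OF conjunct1[OF e\<psi>]]] .
  then show ?thesis
    using conjunct2[OF e\<phi>] conjunct2[OF e\<psi>] unfolding pair_homotopy_def by blast
qed

lemma compose_pair_maps:
  assumes "\<alpha> \<in> pair_maps Z S M m" "continuous_map M Y e" "e m = y0" "S \<subseteq> topspace Z"
  shows "compose (topspace Z) e \<alpha> \<in> pair_maps Z S Y y0"
proof -
  have "homotopic_with (\<lambda>k. k ` S \<subseteq> {m}) Z M \<alpha> \<alpha>"
    using assms(1) by (intro homotopic_with_equal) (auto simp: pair_maps_def)
  from compose_pair_homotopic[OF this assms(2) _ assms(4)] assms(3) show ?thesis
    by (intro pair_homotopyD(1)) simp
qed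


section \<open>Reparametrizations of the cube\<close>

lemma topspace_cube: "topspace (cube n) = PiE {..<n} (\<lambda>_. {0..1})"
  by (simp add: cube_def)

lemma cube_boundary_subset: "cube_boundary n \<subseteq> topspace (cube n)"
  by (auto simp: cube_boundary_def)

lemma cube_coord: "x \<in> topspace (cube n) \<Longrightarrow> i < n \<Longrightarrow> 0 \<le> x i \<and> x i \<le> 1"
  by (auto simp: topspace_cube PiE_iff)

lemma continuous_map_cube_coord:
  assumes "i < n"
  shows "continuous_map (cube n) (top_of_set {0..1}) (\<lambda>x. x i)"
  using assms continuous_map_product_projection[of i "{..<n}" "\<lambda>_. top_of_set {0..1::real}"]
  by (simp add: cube_def)

lemma continuous_map_cube_coord_real:
  "i < n \<Longrightarrow> continuous_map (cube n) euclideanreal (\<lambda>x. x i)"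
  using continuous_map_cube_coord[of i n] by (simp add: continuous_map_in_subtopology)

lemma continuous_map_into_cube:
  assumes "\<And>i. i < n \<Longrightarrow> continuous_map Z euclideanreal (\<lambda>z. p z i)"
    and "\<And>z. z \<in> topspace Z \<Longrightarrow> p z \<in> topspace (cube n)"
  shows "continuous_map Z (cube n) p"
  unfolding cube_def continuous_map_componentwise
  using assms by (auto simp: continuous_map_in_subtopology topspace_cube PiE_iff)

text \<open>Two self-maps of the cube are joined by the straight line between them. This line stays
  in the boundary over a boundary point as soon as both maps send that point into a common face.\<close>

lemma straight_line_cube_homotopy:
  assumes \<phi>: "continuous_map (cube n) (cube n) \<phi>" and \<psi>: "continuous_map (cube n) (cube n) \<psi>"
    and face: "\<And>x. x \<in> cube_boundary n \<Longrightarrow> \<exists>i<n. \<phi> x i = \<psi> x i \<and> (\<phi> x i = 0 \<or> \<phi> x i = 1)"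
  shows "homotopic_with (\<lambda>k. k ` cube_boundary n \<subseteq> cube_boundary n) (cube n) (cube n) \<phi> \<psi>"
proof -
  define h where "h = (\<lambda>z. \<lambda>i\<in>{..<n}. (1 - fst z) * \<phi> (snd z) i + fst z * \<psi> (snd z) i)"
  let ?Z = "prod_topology (top_of_set {0..1::real}) (cube n)"
  have into: "\<phi> x \<in> topspace (cube n)" "\<psi> x \<in> topspace (cube n)" if "x \<in> topspace (cube n)" for x
    using that continuous_map_image_subset_topspace[OF \<phi>] continuous_map_image_subset_topspace[OF \<psi>]
    by blast+
  have mem: "h (t, x) \<in> topspace (cube n)" if "0 \<le> t" "t \<le> 1" "x \<in> topspace (cube n)" for t x
  proof -
    have "0 \<le> (1 - t) * \<phi> x i + t * \<psi> x i \<and> (1 - t) * \<phi> x i + t * \<psi> x i \<le> 1" if i: "i < n" for i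
      using cube_coord[OF into(1) i] cube_coord[OF into(2) i] \<open>x \<in> _\<close> \<open>0 \<le> t\<close> \<open>t \<le> 1\<close>
      by (simp add: convex_bound_le)
    then show ?thesis
      by (simp add: topspace_cube h_def)
  qed
  have coord: "continuous_map ?Z euclideanreal (\<lambda>z. h z i)" if i: "i < n" for i
  proof -
    have t: "continuous_map ?Z euclideanreal fst"
      using continuous_map_fst[of "top_of_set {0..1::real}" "cube n"]
      by (simp add: continuous_map_in_subtopology)
    have c: "continuous_map ?Z euclideanreal (\<lambda>z. k (snd z) i)"
      if "continuous_map (cube n) (cube n) k" for k
      using continuous_map_compose[OF continuous_map_compose[OF continuous_map_snd that]
          continuous_map_cube_coord_real[OF i]]
      by (simp add: o_def)
    have "continuous_map ?Z euclideanreal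
        (\<lambda>z. (1 - fst z) * \<phi> (snd z) i + fst z * \<psi> (snd z) i)"
      by (intro continuous_intros t c \<phi> \<psi>)
    then show ?thesis
      using i by (simp add: h_def)
  qed
  have "continuous_map ?Z (cube n) h"
    by (rule continuous_map_into_cube[OF coord]) (use mem in auto)
  moreover have "h (0, x) = \<phi> x" "h (1, x) = \<psi> x" if "x \<in> topspace (cube n)" for x
    using into[OF that] by (auto simp: topspace_cube h_def PiE_iff extensional_restrict)
  moreover have "h (t, x) \<in> cube_boundary n" if t: "t \<in> {0..1}" and x: "x \<in> cube_boundary n" for t x
  proof -
    obtain i where i: "i < n" "\<phi> x i = \<psi> x i" "\<phi> x i = 0 \<or> \<phi> x i = 1"
      using face[OF x] by blast
    then have "h (t, x) i = 0 \<or> h (t, x) i = 1"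
      by (auto simp: h_def)
    moreover have "h (t, x) \<in> topspace (cube n)"
      using t x cube_boundary_subset[of n] by (intro mem) auto
    ultimately show ?thesis
      using i(1) unfolding cube_boundary_def by blast
  qed
  ultimately show ?thesis
    by (rule homotopic_with_pairI[OF _ _ _ _ cube_boundary_subset])
qed

lemma reparametrized_cube_homotopic:
  assumes "\<alpha> \<in> pair_maps (cube n) (cube_boundary n) Y y0"
    and "continuous_map (cube n) (cube n) \<phi>" "continuous_map (cube n) (cube n) \<psi>"
    and "\<And>x. x \<in> cube_boundary n \<Longrightarrow> \<exists>i<n. \<phi> x i = \<psi> x i \<and> (\<phi> x i = 0 \<or> \<phi> x i = 1)"
  shows "(compose (topspace (cube n)) \<alpha> \<phi>, compose (topspace (cube n)) \<alpha> \<psi>)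
    \<in> pair_homotopy (cube n) (cube_boundary n) Y y0"
  using assms(1)
  by (intro compose_pair_homotopic[OF straight_line_cube_homotopy[OF assms(2-4)]])
    (auto simp: pair_maps_def cube_boundary_subset)

lemma continuous_map_reparam_coord0:
  assumes "n \<ge> 1" "continuous_on {0..1} u" "u ` {0..1} \<subseteq> {0..1::real}"
  shows "continuous_map (cube n) (cube n) (\<lambda>x. x(0 := u (x 0)))"
proof (rule continuous_map_into_cube)
  fix i assume i: "i < n"
  have "continuous_map (top_of_set {0..1}) euclideanreal u"
    using assms(2) by simp
  from continuous_map_compose[OF continuous_map_cube_coord[of 0 n] this] assms(1)
  have "continuous_map (cube n) euclideanreal (\<lambda>x. u (x 0))"
    by (simp add: o_def)
  then show "continuous_map (cube n) euclideanreal (\<lambda>x. (x(0 := u (x 0))) i)"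
    using continuous_map_cube_coord_real[OF i] by (cases "i = 0") simp_all
next
  fix x assume x: "x \<in> topspace (cube n)"
  then have "u (x 0) \<in> {0..1}"
    using assms(1,3) cube_coord[OF x, of 0] by fastforce
  then show "x(0 := u (x 0)) \<in> topspace (cube n)"
    using x assms(1) by (auto simp: topspace_cube PiE_iff extensional_def)
qed

text \<open>In coordinate \<open>0\<close> it suffices that both maps have the same end values and that these are
  themselves ends of the interval. The two end values may coincide, as needed for inverses.\<close>

lemma reparam_coord0_homotopic:
  assumes "n \<ge> 1" "\<alpha> \<in> pair_maps (cube n) (cube_boundary n) Y y0"
    and "continuous_on {0..1} u" "u ` {0..1} \<subseteq> {0..1::real}"
    and "continuous_on {0..1} v" "v ` {0..1} \<subseteq> {0..1::real}"
    and "u 0 = v 0" "u 1 = v 1" "u 0 \<in> {0, 1}" "u 1 \<in> {0, 1}"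
  shows "(compose (topspace (cube n)) \<alpha> (\<lambda>x. x(0 := u (x 0))),
          compose (topspace (cube n)) \<alpha> (\<lambda>x. x(0 := v (x 0))))
    \<in> pair_homotopy (cube n) (cube_boundary n) Y y0"
proof (rule reparametrized_cube_homotopic[OF assms(2)])
  fix x assume "x \<in> cube_boundary n"
  then obtain i where "i < n" "x i = 0 \<or> x i = 1"
    by (auto simp: cube_boundary_def)
  then show "\<exists>i<n. (x(0 := u (x 0))) i = (x(0 := v (x 0))) i \<and>
      ((x(0 := u (x 0))) i = 0 \<or> (x(0 := u (x 0))) i = 1)"
    using assms by (intro exI[of _ i]) auto
qed (rule continuous_map_reparam_coord0[OF assms(1,3,4)],
    rule continuous_map_reparam_coord0[OF assms(1,5,6)])


section \<open>The homotopy groups are groups\<close>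

lemma const_cube_map:
  "y0 \<in> topspace Y \<Longrightarrow>
    (\<lambda>x\<in>topspace (cube n). y0) \<in> pair_maps (cube n) (cube_boundary n) Y y0"
  using cube_boundary_subset[of n] by (auto simp: pair_maps_def)

text \<open>Concatenating the two homotopies at each time is a homotopy of concatenations. The coordinate changes
  \<open>2t\<close> and \<open>2t - 1\<close> are truncated to the unit interval, so that both branches are continuous on the
  whole cube before they are pasted along \<open>t = 1/2\<close>.\<close>

lemma cube_concat_homotopic:
  assumes n: "n \<ge> 1"
    and \<alpha>: "(\<alpha>, \<alpha>') \<in> pair_homotopy (cube n) (cube_boundary n) Y y0"
    and \<beta>: "(\<beta>, \<beta>') \<in> pair_homotopy (cube n) (cube_boundary n) Y y0"
  shows "(cube_concat n \<alpha> \<beta>, cube_concat n \<alpha>' \<beta>') \<in> pair_homotopy (cube n) (cube_boundary n) Y y0"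
proof -
  let ?l = "\<lambda>x::nat \<Rightarrow> real. x(0 := min 1 (2 * x 0))"
  let ?r = "\<lambda>x::nat \<Rightarrow> real. x(0 := max 0 (2 * x 0 - 1))"
  let ?Z = "prod_topology (top_of_set {0..1::real}) (cube n)"
  obtain h where h: "continuous_map ?Z Y h" "\<And>x. h (0, x) = \<alpha> x" "\<And>x. h (1, x) = \<alpha>' x"
    "\<And>t x. t \<in> {0..1} \<Longrightarrow> x \<in> cube_boundary n \<Longrightarrow> h (t, x) = y0"
    using \<alpha> by (rule pair_homotopyE) blast
  obtain k where k: "continuous_map ?Z Y k" "\<And>x. k (0, x) = \<beta> x" "\<And>x. k (1, x) = \<beta>' x"
    "\<And>t x. t \<in> {0..1} \<Longrightarrow> x \<in> cube_boundary n \<Longrightarrow> k (t, x) = y0"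
    using \<beta> by (rule pair_homotopyE) blast
  have lr: "continuous_map (cube n) (cube n) ?l" "continuous_map (cube n) (cube n) ?r"
    by (rule continuous_map_reparam_coord0[OF n]; auto intro!: continuous_intros)+
  let ?h = "\<lambda>z. if snd z 0 \<le> 1/2 then h (fst z, ?l (snd z)) else k (fst z, ?r (snd z))"
  \<comment> \<open>Boundary values: \<open>l\<close> is applied in the half that contains the face \<open>x 0 = 0\<close>, and \<open>r\<close> in the
      half that contains the face \<open>x 0 = 1\<close>. At the common wall \<open>x 0 = 1/2\<close> both branches
      equal \<open>y0\<close>, since \<open>l\<close> and \<open>r\<close> send the wall into the boundary.\<close>
  have lb: "?l x \<in> cube_boundary n" if x: "x \<in> topspace (cube n)"
    and i: "i < n" "x i = 0 \<or> x i = 1" "i = 0 \<longrightarrow> x 0 = 0" for x i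
    using continuous_map_image_subset_topspace[OF lr(1)] x i n
    by (auto simp: cube_boundary_def intro!: exI[of _ i])
  have lh: "?l x \<in> cube_boundary n" if x: "x \<in> topspace (cube n)" and "x 0 = 1/2" for x
    using continuous_map_image_subset_topspace[OF lr(1)] that n
    by (auto simp: cube_boundary_def intro!: exI[of _ 0])
  have rb: "?r x \<in> cube_boundary n" if x: "x \<in> topspace (cube n)"
    and i: "i < n" "x i = 0 \<or> x i = 1" "i = 0 \<longrightarrow> x 0 = 1" for x i
    using continuous_map_image_subset_topspace[OF lr(2)] x i n
    by (auto simp: cube_boundary_def intro!: exI[of _ i])
  have rh: "?r x \<in> cube_boundary n" if x: "x \<in> topspace (cube n)" and "x 0 = 1/2" for x
    using continuous_map_image_subset_topspace[OF lr(2)] that n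
    by (auto simp: cube_boundary_def intro!: exI[of _ 0])
  have pr: "continuous_map ?Z ?Z (\<lambda>z. (fst z, p (snd z)))"
    if "continuous_map (cube n) (cube n) p" for p
    using that continuous_map_compose[OF continuous_map_snd that]
    by (auto simp: continuous_map_pairwise o_def continuous_map_fst)
  have ch: "continuous_map ?Z Y ?h"
  proof (rule continuous_map_cases_le)
    show "continuous_map ?Z euclideanreal (\<lambda>z. snd z 0)"
      using continuous_map_compose[OF continuous_map_snd continuous_map_cube_coord_real[of 0 n]] n
      by (force simp: o_def)
    show "continuous_map (subtopology ?Z {x \<in> topspace ?Z. snd x 0 \<le> 1 / 2}) Y
        (\<lambda>z. h (fst z, ?l (snd z)))"
      using continuous_map_compose[OF pr[OF lr(1)] h(1)]
      by (intro continuous_map_from_subtopology) (simp add: o_def)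
    show "continuous_map (subtopology ?Z {x \<in> topspace ?Z. 1 / 2 \<le> snd x 0}) Y
        (\<lambda>z. k (fst z, ?r (snd z)))"
      using continuous_map_compose[OF pr[OF lr(2)] k(1)]
      by (intro continuous_map_from_subtopology) (simp add: o_def)
    show "h (fst z, ?l (snd z)) = k (fst z, ?r (snd z))"
      if "z \<in> topspace ?Z" "snd z 0 = 1/2" for z
      using that h(4)[of "fst z", OF _ lh[of "snd z"]] k(4)[of "fst z", OF _ rh[of "snd z"]] by auto
  qed auto
  have hb: "?h (t, x) = y0" if t: "t \<in> {0..1}" and x: "x \<in> cube_boundary n" for t x
  proof -
    from x obtain i where i: "i < n" "x i = 0 \<or> x i = 1" "x \<in> topspace (cube n)"
      by (auto simp: cube_boundary_def)
    show ?thesis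
    proof (cases "x 0 \<le> 1/2")
      case True
      then have "i = 0 \<longrightarrow> x 0 = 0" using i by auto
      then show ?thesis
        using True h(4)[OF t lb[OF i(3,1,2)]] by simp
    next
      case False
      then have "i = 0 \<longrightarrow> x 0 = 1" using i by auto
      then show ?thesis
        using False k(4)[OF t rb[OF i(3,1,2)]] by simp
    qed
  qed
  have ends: "?h (0, x) = cube_concat n \<alpha> \<beta> x" "?h (1, x) = cube_concat n \<alpha>' \<beta>' x"
    if "x \<in> topspace (cube n)" for x
    using that h(2,3) k(2,3)
    by (cases "x 0 \<le> 1/2"; simp add: cube_concat_def min_absorb2 max_absorb2)+
  have "homotopic_with (\<lambda>p. p ` cube_boundary n \<subseteq> {y0}) (cube n) Y
      (cube_concat n \<alpha> \<beta>) (cube_concat n \<alpha>' \<beta>')"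
    using ch ends hb by (intro homotopic_with_pairI[of _ _ ?h]) (auto simp: cube_boundary_subset)
  moreover from homotopic_with_imp_continuous_maps[OF this] homotopic_with_imp_property[OF this]
  have "cube_concat n \<alpha> \<beta> \<in> pair_maps (cube n) (cube_boundary n) Y y0"
    "cube_concat n \<alpha>' \<beta>' \<in> pair_maps (cube n) (cube_boundary n) Y y0"
    by (auto simp: pair_maps_def cube_concat_def)
  ultimately show ?thesis
    by (simp add: pair_homotopy_def)
qed

lemma cube_concat_pair_maps:
  assumes "n \<ge> 1" "\<alpha> \<in> pair_maps (cube n) (cube_boundary n) Y y0"
    "\<beta> \<in> pair_maps (cube n) (cube_boundary n) Y y0"
  shows "cube_concat n \<alpha> \<beta> \<in> pair_maps (cube n) (cube_boundary n) Y y0"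
  by (rule pair_homotopyD(1)[OF cube_concat_homotopic[OF assms(1)
        pair_homotopy_refl[OF assms(2)] pair_homotopy_refl[OF assms(3)]]])

lemma homotopy_group_mult:
  assumes "n \<ge> 1" "\<alpha> \<in> pair_maps (cube n) (cube_boundary n) Y y0"
    "\<beta> \<in> pair_maps (cube n) (cube_boundary n) Y y0"
  shows "cube_class n Y y0 \<alpha> \<otimes>\<^bsub>homotopy_group n Y y0\<^esub> cube_class n Y y0 \<beta> =
    cube_class n Y y0 (cube_concat n \<alpha> \<beta>)"
proof -
  have "cube_class n Y y0 (cube_concat n \<alpha>' \<beta>') = cube_class n Y y0 (cube_concat n \<alpha> \<beta>)"
    if "\<alpha>' \<in> cube_class n Y y0 \<alpha>" "\<beta>' \<in> cube_class n Y y0 \<beta>" for \<alpha>' \<beta>'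
  proof -
    have "(\<alpha>, \<alpha>') \<in> pair_homotopy (cube n) (cube_boundary n) Y y0"
      "(\<beta>, \<beta>') \<in> pair_homotopy (cube n) (cube_boundary n) Y y0"
      using that by (simp_all add: pair_class_def)
    from pair_class_eqI[OF cube_concat_homotopic[OF assms(1) this]] show ?thesis
      by (rule sym)
  qed
  then have "(\<Union>\<alpha>'\<in>cube_class n Y y0 \<alpha>. \<Union>\<beta>'\<in>cube_class n Y y0 \<beta>.
      cube_class n Y y0 (cube_concat n \<alpha>' \<beta>')) = cube_class n Y y0 (cube_concat n \<alpha> \<beta>)"
    using pair_class_self[OF assms(2)] pair_class_self[OF assms(3)] by blast
  then show ?thesis
    by (simp add: homotopy_group_def)
qed

definition cube_reverse :: "nat \<Rightarrow> ((nat \<Rightarrow> real) \<Rightarrow> 'a) \<Rightarrow> (nat \<Rightarrow> real) \<Rightarrow> 'a" where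
  "cube_reverse n \<alpha> = compose (topspace (cube n)) \<alpha> (\<lambda>x. x(0 := 1 - x 0))"

lemma cube_reverse_pair_maps:
  assumes "n \<ge> 1" "\<alpha> \<in> pair_maps (cube n) (cube_boundary n) Y y0"
  shows "cube_reverse n \<alpha> \<in> pair_maps (cube n) (cube_boundary n) Y y0"
proof -
  have "(compose (topspace (cube n)) \<alpha> (\<lambda>x. x(0 := 1 - x 0)),
         compose (topspace (cube n)) \<alpha> (\<lambda>x. x(0 := 1 - x 0)))
      \<in> pair_homotopy (cube n) (cube_boundary n) Y y0"
    by (rule reparam_coord0_homotopic[OF assms]) (auto intro!: continuous_intros)
  then show ?thesis
    unfolding cube_reverse_def by (rule pair_homotopyD)
qed

lemma compose_cube_id:
  "\<alpha> \<in> pair_maps (cube n) S Y y0 \<Longrightarrow>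
    compose (topspace (cube n)) \<alpha> (\<lambda>x. x(0 := x 0)) = \<alpha>"
  by (auto simp: compose_def fun_eq_iff pair_maps_def extensional_def)

lemma update_coord0_in_cube:
  "n \<ge> 1 \<Longrightarrow> x \<in> topspace (cube n) \<Longrightarrow> 0 \<le> t \<Longrightarrow> t \<le> 1 \<Longrightarrow> x(0 := t) \<in> topspace (cube n)"
  by (auto simp: topspace_cube PiE_iff extensional_def)

text \<open>Each group law says that reparametrizing one cube in coordinate \<open>0\<close> by a map \<open>u\<close> does not
  change its class, because \<open>u\<close> has the same end values as a simpler map (the identity, or a constant).
  For the unit law, \<open>u\<close> rests at \<open>0\<close> during the first half, where \<open>\<alpha>\<close> has its boundary value.\<close>

lemma cube_concat_const_left:
  assumes "n \<ge> 1" "\<alpha> \<in> pair_maps (cube n) (cube_boundary n) Y y0"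
  shows "(cube_concat n (\<lambda>x\<in>topspace (cube n). y0) \<alpha>, \<alpha>)
    \<in> pair_homotopy (cube n) (cube_boundary n) Y y0"
proof -
  let ?u = "\<lambda>t::real. max 0 (2 * t - 1)"
  have "(compose (topspace (cube n)) \<alpha> (\<lambda>x. x(0 := ?u (x 0))),
         compose (topspace (cube n)) \<alpha> (\<lambda>x. x(0 := x 0)))
      \<in> pair_homotopy (cube n) (cube_boundary n) Y y0"
    by (rule reparam_coord0_homotopic[OF assms]) (auto intro!: continuous_intros)
  moreover have "compose (topspace (cube n)) \<alpha> (\<lambda>x. x(0 := ?u (x 0))) =
      cube_concat n (\<lambda>x\<in>topspace (cube n). y0) \<alpha>"
  proof
    fix x :: "nat \<Rightarrow> real"
    have "\<alpha> (x(0 := 0)) = y0" if "x \<in> topspace (cube n)"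
    proof -
      have "x(0 := 0) \<in> cube_boundary n"
        using update_coord0_in_cube[OF assms(1) that, of 0] assms(1)
        by (auto simp: cube_boundary_def intro!: exI[of _ 0])
      then show ?thesis
        using assms(2) by (auto simp: pair_maps_def)
    qed
    then show "compose (topspace (cube n)) \<alpha> (\<lambda>x. x(0 := ?u (x 0))) x =
        cube_concat n (\<lambda>x\<in>topspace (cube n). y0) \<alpha> x"
      using update_coord0_in_cube[OF assms(1), of x "2 * x 0"] cube_coord[of x n 0] assms(1)
      by (cases "x 0 \<le> 1/2") (auto simp: compose_def cube_concat_def max_absorb1 max_absorb2)
  qed
  ultimately show ?thesis
    using compose_cube_id[OF assms(2)] by simp
qed

text \<open>Here \<open>u\<close> runs from \<open>1\<close> down to \<open>0\<close> and back. Both of its ends are \<open>1\<close>, so it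
  contracts to the constant \<open>1\<close>.\<close>

lemma cube_concat_reverse:
  assumes "n \<ge> 1" "\<alpha> \<in> pair_maps (cube n) (cube_boundary n) Y y0"
  shows "(cube_concat n (cube_reverse n \<alpha>) \<alpha>, \<lambda>x\<in>topspace (cube n). y0)
    \<in> pair_homotopy (cube n) (cube_boundary n) Y y0"
proof -
  let ?u = "\<lambda>t::real. \<bar>2 * t - 1\<bar>"
  have "(compose (topspace (cube n)) \<alpha> (\<lambda>x. x(0 := ?u (x 0))),
         compose (topspace (cube n)) \<alpha> (\<lambda>x. x(0 := 1)))
      \<in> pair_homotopy (cube n) (cube_boundary n) Y y0"
    by (rule reparam_coord0_homotopic[OF assms]) (auto intro!: continuous_intros)
  moreover have "compose (topspace (cube n)) \<alpha> (\<lambda>x. x(0 := ?u (x 0))) =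
      cube_concat n (cube_reverse n \<alpha>) \<alpha>"
  proof
    fix x :: "nat \<Rightarrow> real"
    have "?u (x 0) = (if x 0 \<le> 1/2 then 1 - 2 * x 0 else 2 * x 0 - 1)"
      by auto
    then show "compose (topspace (cube n)) \<alpha> (\<lambda>x. x(0 := ?u (x 0))) x =
        cube_concat n (cube_reverse n \<alpha>) \<alpha> x"
      using update_coord0_in_cube[OF assms(1), of x "2 * x 0"] cube_coord[of x n 0] assms(1)
      by (simp add: compose_def cube_concat_def cube_reverse_def)
  qed
  moreover have "compose (topspace (cube n)) \<alpha> (\<lambda>x. x(0 := 1)) = (\<lambda>x\<in>topspace (cube n). y0)"
  proof
    fix x :: "nat \<Rightarrow> real"
    have "\<alpha> (x(0 := 1)) = y0" if "x \<in> topspace (cube n)"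
    proof -
      have "x(0 := 1) \<in> cube_boundary n"
        using update_coord0_in_cube[OF assms(1) that, of 1] assms(1)
        by (auto simp: cube_boundary_def intro!: exI[of _ 0])
      then show ?thesis
        using assms(2) by (auto simp: pair_maps_def)
    qed
    then show "compose (topspace (cube n)) \<alpha> (\<lambda>x. x(0 := 1)) x = (\<lambda>x\<in>topspace (cube n). y0) x"
      by (auto simp: compose_def)
  qed
  ultimately show ?thesis
    by simp
qed

text \<open>The breakpoints \<open>1/4, 1/2\<close> of \<open>(\<alpha>\<beta>)\<gamma>\<close> must be sent to the breakpoints \<open>1/2, 3/4\<close> of
  \<open>\<alpha>(\<beta>\<gamma>)\<close>. The piecewise linear map that does this has slopes \<open>2, 1, 1/2\<close>, hence is concave and equal
  to the minimum of its three linear pieces.\<close>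

lemma cube_concat_assoc:
  assumes "n \<ge> 1" "\<alpha> \<in> pair_maps (cube n) (cube_boundary n) Y y0"
    "\<beta> \<in> pair_maps (cube n) (cube_boundary n) Y y0"
    "\<gamma> \<in> pair_maps (cube n) (cube_boundary n) Y y0"
  shows "(cube_concat n (cube_concat n \<alpha> \<beta>) \<gamma>, cube_concat n \<alpha> (cube_concat n \<beta> \<gamma>))
    \<in> pair_homotopy (cube n) (cube_boundary n) Y y0"
proof -
  let ?\<delta> = "cube_concat n \<alpha> (cube_concat n \<beta> \<gamma>)"
  let ?u = "\<lambda>t::real. min (2 * t) (min (t + 1/4) ((t + 1) / 2))"
  have \<delta>: "?\<delta> \<in> pair_maps (cube n) (cube_boundary n) Y y0"
    using assms by (intro cube_concat_pair_maps)
  have "(compose (topspace (cube n)) ?\<delta> (\<lambda>x. x(0 := ?u (x 0))),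
         compose (topspace (cube n)) ?\<delta> (\<lambda>x. x(0 := x 0)))
      \<in> pair_homotopy (cube n) (cube_boundary n) Y y0"
    by (rule reparam_coord0_homotopic[OF assms(1) \<delta>])
      (auto intro!: continuous_intros simp: min_le_iff_disj)
  moreover have "compose (topspace (cube n)) ?\<delta> (\<lambda>x. x(0 := ?u (x 0))) =
      cube_concat n (cube_concat n \<alpha> \<beta>) \<gamma>"
  proof
    fix x :: "nat \<Rightarrow> real"
    show "compose (topspace (cube n)) ?\<delta> (\<lambda>x. x(0 := ?u (x 0))) x =
        cube_concat n (cube_concat n \<alpha> \<beta>) \<gamma> x"
    proof (cases "x \<in> topspace (cube n)")
      case True
      have x0: "0 \<le> x 0" "x 0 \<le> 1"
        using cube_coord[OF True, of 0] assms(1) by auto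
      note up = update_coord0_in_cube[OF assms(1) True]
      consider "x 0 \<le> 1/4" | "1/4 < x 0" "x 0 \<le> 1/2" | "1/2 < x 0"
        by linarith
      then show ?thesis
      proof cases
        case 1
        then have "?u (x 0) = 2 * x 0" by auto
        then show ?thesis
          using 1 x0 True up[of "2 * x 0"] by (simp add: compose_def cube_concat_def)
      next
        case 2
        then have "?u (x 0) = x 0 + 1/4" by auto
        then show ?thesis
          using 2 x0 True up[of "2 * x 0"] up[of "x 0 + 1/4"] up[of "2 * x 0 - 1/2"]
          by (simp add: compose_def cube_concat_def algebra_simps)
      next
        case 3
        define u where "u = (x 0 + 1) / 2"
        have u: "?u (x 0) = u" "2 * u - 1 = x 0" "1/2 < u" "u \<le> 1"
          using 3 x0 by (auto simp: u_def field_simps)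
        have "compose (topspace (cube n)) ?\<delta> (\<lambda>x. x(0 := ?u (x 0))) x = ?\<delta> (x(0 := u))"
          by (simp only: compose_eq[OF True] u(1))
        also have "\<dots> = cube_concat n (cube_concat n \<alpha> \<beta>) \<gamma> x"
          using 3 x0 True up[of u] u(2-4) by (simp add: cube_concat_def)
        finally show ?thesis .
      qed
    qed (simp add: compose_def cube_concat_def)
  qed
  ultimately show ?thesis
    using compose_cube_id[OF \<delta>] by simp
qed

theorem group_homotopy_group:
  assumes "n \<ge> 1" "y0 \<in> topspace Y"
  shows "group (homotopy_group n Y y0)"
proof (rule groupI)
  let ?P = "pair_maps (cube n) (cube_boundary n) Y y0"
  let ?G = "homotopy_group n Y y0"
  let ?c = "\<lambda>x\<in>topspace (cube n). y0"
  have carr: "carrier ?G = cube_class n Y y0 ` ?P"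
    by (simp add: homotopy_group_def pair_classes_eq_image)
  have one: "\<one>\<^bsub>?G\<^esub> = cube_class n Y y0 ?c"
    by (simp add: homotopy_group_def)
  note mult = homotopy_group_mult[OF assms(1)]
  note c = const_cube_map[OF assms(2), of n]
  show "\<one>\<^bsub>?G\<^esub> \<in> carrier ?G"
    using c by (simp add: one carr)
  fix a assume "a \<in> carrier ?G"
  then obtain \<alpha> where \<alpha>: "\<alpha> \<in> ?P" "a = cube_class n Y y0 \<alpha>"
    by (auto simp: carr)
  show "\<one>\<^bsub>?G\<^esub> \<otimes>\<^bsub>?G\<^esub> a = a"
    using c \<alpha> pair_class_eqI[OF cube_concat_const_left[OF assms(1) \<alpha>(1)]] by (simp add: mult one)
  show "\<exists>b\<in>carrier ?G. b \<otimes>\<^bsub>?G\<^esub> a = \<one>\<^bsub>?G\<^esub>"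
    using \<alpha> cube_reverse_pair_maps[OF assms(1) \<alpha>(1)]
      pair_class_eqI[OF cube_concat_reverse[OF assms(1) \<alpha>(1)]]
    by (auto simp: mult one carr)
  fix b assume "b \<in> carrier ?G"
  then obtain \<beta> where \<beta>: "\<beta> \<in> ?P" "b = cube_class n Y y0 \<beta>"
    by (auto simp: carr)
  show "a \<otimes>\<^bsub>?G\<^esub> b \<in> carrier ?G"
    using \<alpha> \<beta> cube_concat_pair_maps[OF assms(1) \<alpha>(1) \<beta>(1)] by (simp add: mult carr)
  fix d assume "d \<in> carrier ?G"
  then obtain \<delta> where \<delta>: "\<delta> \<in> ?P" "d = cube_class n Y y0 \<delta>"
    by (auto simp: carr)
  show "a \<otimes>\<^bsub>?G\<^esub> b \<otimes>\<^bsub>?G\<^esub> d = a \<otimes>\<^bsub>?G\<^esub> (b \<otimes>\<^bsub>?G\<^esub> d)"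
    using \<alpha> \<beta> \<delta> cube_concat_pair_maps[OF assms(1) \<alpha>(1) \<beta>(1)]
      cube_concat_pair_maps[OF assms(1) \<beta>(1) \<delta>(1)]
      pair_class_eqI[OF cube_concat_assoc[OF assms(1) \<alpha>(1) \<beta>(1) \<delta>(1)]]
    by (simp add: mult)
qed


section \<open>Moving the base point of a cube along a path\<close>

lemma continuous_map_Min:
  assumes "finite I" "I \<noteq> {}" "\<And>i. i \<in> I \<Longrightarrow> continuous_map Z euclideanreal (f i)"
  shows "continuous_map Z euclideanreal (\<lambda>z. Min ((\<lambda>i. f i z) ` I))"
  using assms
proof (induction I rule: finite_ne_induct)
  case (insert i I)
  then have "continuous_map Z euclideanreal (\<lambda>z. min (f i z) (Min ((\<lambda>i. f i z) ` I)))"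
    by (intro continuous_map_real_min) auto
  then show ?case
    using insert.hyps by simp
qed simp

text \<open>The distance of a point to the boundary of the cube in the maximum norm: it vanishes
  exactly on the boundary and is \<open>1/2\<close> at the centre.\<close>

definition cube_depth :: "nat \<Rightarrow> (nat \<Rightarrow> real) \<Rightarrow> real" where
  "cube_depth n x = Min ((\<lambda>i. min (x i) (1 - x i)) ` {..<n})"

text \<open>Dilation by the factor \<open>2\<close> about the centre, followed by clamping each coordinate to the
  unit interval. It stretches the concentric subcube of side \<open>1/2\<close> over the whole cube and sends
  the shell around it, where the depth is at most \<open>1/4\<close>, into the boundary.\<close>

definition cube_zoom :: "nat \<Rightarrow> (nat \<Rightarrow> real) \<Rightarrow> nat \<Rightarrow> real" where
  "cube_zoom n x = (\<lambda>i\<in>{..<n}. max 0 (min 1 (2 * x i - 1/2)))"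

lemma continuous_map_cube_depth:
  assumes "n \<ge> 1"
  shows "continuous_map (cube n) euclideanreal (cube_depth n)"
  unfolding cube_depth_def
proof (rule continuous_map_Min)
  fix i assume "i \<in> {..<n}"
  then have "continuous_map (cube n) euclideanreal (\<lambda>x. x i)"
    by (simp add: continuous_map_cube_coord_real)
  then show "continuous_map (cube n) euclideanreal (\<lambda>x. min (x i) (1 - x i))"
    by (intro continuous_map_real_min continuous_map_diff continuous_map_const[THEN iffD2]) auto
qed (use assms in \<open>auto simp: lessThan_empty_iff\<close>)

lemma continuous_map_cube_zoom: "continuous_map (cube n) (cube n) (cube_zoom n)"
proof (rule continuous_map_into_cube)
  fix i assume i: "i < n"
  have "continuous_map (cube n) euclideanreal (\<lambda>x. max 0 (min 1 (2 * x i - 1/2)))"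
    using continuous_map_cube_coord_real[OF i]
    by (intro continuous_map_real_min continuous_map_real_max continuous_map_diff
        continuous_map_real_mult_left continuous_map_const[THEN iffD2]) auto
  then show "continuous_map (cube n) euclideanreal (\<lambda>x. cube_zoom n x i)"
    using i by (simp add: cube_zoom_def)
qed (auto simp: cube_zoom_def topspace_cube)

lemma cube_depth_nonneg: "n \<ge> 1 \<Longrightarrow> x \<in> topspace (cube n) \<Longrightarrow> 0 \<le> cube_depth n x"
  using cube_coord[of x n] by (auto simp: cube_depth_def Min_ge_iff lessThan_empty_iff)

lemma cube_depth_boundary:
  assumes "x \<in> cube_boundary n"
  shows "cube_depth n x = 0"
proof -
  obtain i where i: "i < n" "x i = 0 \<or> x i = 1" and x: "x \<in> topspace (cube n)"
    using assms by (auto simp: cube_boundary_def)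
  have "cube_depth n x \<le> min (x i) (1 - x i)"
    unfolding cube_depth_def using i(1) by (intro Min_le) auto
  moreover have "n \<ge> 1"
    using i(1) by simp
  ultimately show ?thesis
    using i(2) cube_depth_nonneg[OF _ x] by (auto simp: min_def split: if_splits)
qed

lemma cube_zoom_outer:
  assumes "n \<ge> 1" "x \<in> topspace (cube n)" "cube_depth n x \<le> 1/4"
  shows "cube_zoom n x \<in> cube_boundary n"
proof -
  have "cube_depth n x \<in> (\<lambda>i. min (x i) (1 - x i)) ` {..<n}"
    unfolding cube_depth_def using assms(1) by (intro Min_in) (auto simp: lessThan_empty_iff)
  then obtain i where i: "i < n" and "min (x i) (1 - x i) \<le> 1/4"
    using assms(3) by auto
  then consider "x i \<le> 1/4" | "3/4 \<le> x i"
    by (cases "x i \<le> 1 - x i") (simp_all add: min_def)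
  then have "cube_zoom n x i = 0 \<or> cube_zoom n x i = 1"
    using i by cases (simp_all add: cube_zoom_def max_absorb1 max_absorb2 min_absorb1)
  moreover have "cube_zoom n x \<in> topspace (cube n)"
    by (auto simp: cube_zoom_def topspace_cube)
  ultimately show ?thesis
    using i unfolding cube_boundary_def by blast
qed

text \<open>The new cube is \<open>\<alpha>\<close> on the inner subcube and runs outwards along \<open>\<gamma>\<close>, from \<open>\<gamma> 1\<close> to
  \<open>\<gamma> 0\<close>, through the shell. Since \<open>e \<circ> \<gamma>\<close> is constant, composing with \<open>e\<close> gives
  \<open>e \<circ> \<alpha> \<circ> cube_zoom\<close> on the whole cube. The clamped dilation fixes each coordinate that is \<open>0\<close>
  or \<open>1\<close>, so it is homotopic to the identity through maps preserving the boundary.\<close>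

lemma base_point_change:
  assumes n: "n \<ge> 1"
    and \<gamma>: "continuous_map (top_of_set {0..1::real}) M \<gamma>"
    and \<alpha>: "\<alpha> \<in> pair_maps (cube n) (cube_boundary n) M (\<gamma> 1)"
    and e: "continuous_map M Y e" "\<And>t. t \<in> {0..1} \<Longrightarrow> e (\<gamma> t) = y0"
  shows "\<exists>\<alpha>' \<in> pair_maps (cube n) (cube_boundary n) M (\<gamma> 0).
    (compose (topspace (cube n)) e \<alpha>', compose (topspace (cube n)) e \<alpha>)
      \<in> pair_homotopy (cube n) (cube_boundary n) Y y0"
proof -
  let ?d = "cube_depth n" and ?c = "cube_zoom n" and ?I = "topspace (cube n)"
  let ?g = "\<lambda>x. min 1 (4 * ?d x)"
  define \<alpha>' where "\<alpha>' = (\<lambda>x\<in>?I. if 1/4 \<le> ?d x then \<alpha> (?c x) else \<gamma> (?g x))"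
  have \<alpha>c: "continuous_map (cube n) M \<alpha>" and \<alpha>b: "\<And>x. x \<in> cube_boundary n \<Longrightarrow> \<alpha> x = \<gamma> 1"
    using \<alpha> by (auto simp: pair_maps_def)
  have g: "continuous_map (cube n) (top_of_set {0..1}) ?g"
    unfolding continuous_map_in_subtopology
    using continuous_map_cube_depth[OF n] cube_depth_nonneg[OF n]
    by (auto intro!: continuous_map_real_min continuous_map_real_mult_left)
  have cont: "continuous_map (cube n) M (\<lambda>x. if 1/4 \<le> ?d x then \<alpha> (?c x) else \<gamma> (?g x))"
  proof (rule continuous_map_cases_le)
    show "continuous_map (subtopology (cube n) {x \<in> ?I. 1/4 \<le> ?d x}) M (\<lambda>x. \<alpha> (?c x))"
      using continuous_map_compose[OF continuous_map_cube_zoom \<alpha>c]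
      by (intro continuous_map_from_subtopology) (simp add: o_def)
    show "continuous_map (subtopology (cube n) {x \<in> ?I. ?d x \<le> 1/4}) M (\<lambda>x. \<gamma> (?g x))"
      using continuous_map_compose[OF g \<gamma>]
      by (intro continuous_map_from_subtopology) (simp add: o_def)
    show "\<alpha> (?c x) = \<gamma> (?g x)" if "x \<in> ?I" "1/4 = ?d x" for x
      using \<alpha>b[OF cube_zoom_outer[OF n that(1)]] that(2)[symmetric] by simp
  qed (use continuous_map_cube_depth[OF n] in auto)
  then have "continuous_map (cube n) M \<alpha>'"
    by (rule continuous_map_eq) (simp add: \<alpha>'_def)
  moreover have "\<alpha>' x = \<gamma> 0" if "x \<in> cube_boundary n" for x
    using cube_depth_boundary[OF that] that cube_boundary_subset[of n] by (auto simp: \<alpha>'_def)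
  ultimately have \<alpha>': "\<alpha>' \<in> pair_maps (cube n) (cube_boundary n) M (\<gamma> 0)"
    by (auto simp: pair_maps_def \<alpha>'_def)
  have e\<alpha>: "compose ?I e \<alpha> \<in> pair_maps (cube n) (cube_boundary n) Y y0"
    using e(2)[of 1] by (intro compose_pair_maps[OF \<alpha> e(1) _ cube_boundary_subset]) simp
  have "(compose ?I (compose ?I e \<alpha>) ?c, compose ?I (compose ?I e \<alpha>) (\<lambda>x. x))
      \<in> pair_homotopy (cube n) (cube_boundary n) Y y0"
  proof (rule reparametrized_cube_homotopic[OF e\<alpha> continuous_map_cube_zoom])
    show "continuous_map (cube n) (cube n) (\<lambda>x. x)"
      using continuous_map_id[of "cube n"] by (simp add: id_def)
    show "\<exists>i<n. ?c x i = x i \<and> (?c x i = 0 \<or> ?c x i = 1)" if "x \<in> cube_boundary n" for x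
    proof -
      from that obtain i where "i < n" "x i = 0 \<or> x i = 1"
        by (auto simp: cube_boundary_def)
      then show ?thesis
        by (intro exI[of _ i]) (elim disjE; simp add: cube_zoom_def)
    qed
  qed
  moreover have "compose ?I (compose ?I e \<alpha>) ?c = compose ?I e \<alpha>'"
  proof
    fix x
    have "e (\<alpha> (?c x)) = e (\<gamma> (?g x))" if "x \<in> ?I" "\<not> 1/4 \<le> ?d x"
    proof -
      have "\<alpha> (?c x) = \<gamma> 1"
        using that by (intro \<alpha>b cube_zoom_outer[OF n]) auto
      moreover have "?g x \<in> {0..1}"
        using cube_depth_nonneg[OF n that(1)] by auto
      ultimately show ?thesis
        using e(2)[of 1] e(2)[of "?g x"] by simp
    qed
    moreover have "?c x \<in> ?I" if "x \<in> ?I"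
      using that continuous_map_image_subset_topspace[OF continuous_map_cube_zoom] by blast
    ultimately show "compose ?I (compose ?I e \<alpha>) ?c x = compose ?I e \<alpha>' x"
      by (auto simp: compose_def \<alpha>'_def)
  qed
  moreover have "compose ?I (compose ?I e \<alpha>) (\<lambda>x. x) = compose ?I e \<alpha>"
    by (auto simp: compose_def fun_eq_iff)
  ultimately have "(compose ?I e \<alpha>', compose ?I e \<alpha>) \<in> pair_homotopy (cube n) (cube_boundary n) Y y0"
    by simp
  then show ?thesis
    by (rule bexI[OF _ \<alpha>'])
qed


section \<open>Mapping spaces\<close>

lemma continuous_map_evaluation:
  assumes "x0 \<in> topspace X"
  shows "continuous_map (mapping_space X Y) Y (\<lambda>g. g x0)"
  unfolding continuous_map
proof (intro conjI allI impI)
  show "(\<lambda>g. g x0) ` topspace (mapping_space X Y) \<subseteq> topspace Y"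
    using assms by (auto simp: topspace_mapping_space continuous_map_def)
  fix U assume U: "openin Y U"
  have "{g \<in> topspace (mapping_space X Y). g x0 \<in> U} =
      {f \<in> extensional (topspace X). continuous_map X Y f \<and> f ` {x0} \<subseteq> U}"
    by (auto simp: topspace_mapping_space)
  also have "openin (mapping_space X Y) \<dots>"
    unfolding mapping_space_def
    using U assms by (intro topology_generated_by_Basis) (blast intro: finite_imp_compactin)
  finally show "openin (mapping_space X Y) {g \<in> topspace (mapping_space X Y). g x0 \<in> U}" .
qed

text \<open>Continuity into the compact-open topology needs to be tested on the generating open sets only.\<close>

lemma continuous_map_into_mapping_space:
  assumes "\<And>z. z \<in> topspace Z \<Longrightarrow> p z \<in> extensional (topspace X) \<and> continuous_map X Y (p z)"
    and "\<And>K U. compactin X K \<Longrightarrow> openin Y U \<Longrightarrow> openin Z {z \<in> topspace Z. p z ` K \<subseteq> U}"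
  shows "continuous_map Z (mapping_space X Y) p"
  unfolding mapping_space_def continuous_on_generated_topo_iff
proof (intro conjI allI impI)
  fix V assume "V \<in> {{f \<in> extensional (topspace X). continuous_map X Y f \<and> f ` K \<subseteq> U} | K U.
      compactin X K \<and> openin Y U}"
  then obtain K U where KU: "compactin X K" "openin Y U"
    and V: "V = {f \<in> extensional (topspace X). continuous_map X Y f \<and> f ` K \<subseteq> U}"
    by blast
  have "p -` V \<inter> topspace Z = {z \<in> topspace Z. p z ` K \<subseteq> U}"
    using assms(1) by (auto simp: V)
  then show "openin Z (p -` V \<inter> topspace Z)"
    using assms(2)[OF KU] by simp
next
  show "p ` topspace Z \<subseteq> \<Union> {{f \<in> extensional (topspace X). continuous_map X Y f \<and> f ` K \<subseteq> U} | K U.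
      compactin X K \<and> openin Y U}"
    using assms(1) by (auto intro!: exI[of _ "{}"])
qed

lemma continuous_map_precompose:
  assumes s: "continuous_map W X s"
  shows "continuous_map (mapping_space X Y) (mapping_space W Y) (\<lambda>g. compose (topspace W) g s)"
proof (rule continuous_map_into_mapping_space)
  fix g assume "g \<in> topspace (mapping_space X Y)"
  then have "continuous_map W Y (g \<circ> s)"
    by (intro continuous_map_compose[OF s]) (simp add: topspace_mapping_space)
  then have "continuous_map W Y (compose (topspace W) g s)"
    by (rule continuous_map_eq) (simp add: compose_def)
  then show "compose (topspace W) g s \<in> extensional (topspace W) \<and>
      continuous_map W Y (compose (topspace W) g s)"
    by simp
next
  fix K U assume K: "compactin W K" and U: "openin Y U"
  have sub: "K \<subseteq> topspace W"
    using K by (rule compactin_subset_topspace)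
  have "{g \<in> topspace (mapping_space X Y). compose (topspace W) g s ` K \<subseteq> U} =
      {f \<in> extensional (topspace X). continuous_map X Y f \<and> f ` (s ` K) \<subseteq> U}"
    using sub by (auto simp: topspace_mapping_space compose_def image_subset_iff subset_iff)
  also have "openin (mapping_space X Y) \<dots>"
    unfolding mapping_space_def
    using U image_compactin[OF K s] by (intro topology_generated_by_Basis) blast
  finally show "openin (mapping_space X Y)
      {g \<in> topspace (mapping_space X Y). compose (topspace W) g s ` K \<subseteq> U}" .
qed

text \<open>Adjunction in the direction that is valid for all spaces. The parameters \<open>t\<close> that violate
  \<open>h({t} \<times> K) \<subseteq> U\<close> form the projection of a closed subset of \<open>T \<times> K\<close>, and the projection along
  the compact \<open>K\<close> is a closed map.\<close>

lemma continuous_map_curry_mapping_space: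
  assumes h: "continuous_map (prod_topology T X) Y h"
  shows "continuous_map T (mapping_space X Y) (\<lambda>t. \<lambda>x\<in>topspace X. h (t, x))"
proof (rule continuous_map_into_mapping_space)
  fix t assume t: "t \<in> topspace T"
  have "continuous_map X Y (h \<circ> (\<lambda>x. (t, x)))"
    using t by (intro continuous_map_compose[OF _ h]) (simp add: continuous_map_pairwise o_def)
  then have "continuous_map X Y (\<lambda>x\<in>topspace X. h (t, x))"
    by (rule continuous_map_eq) simp
  then show "(\<lambda>x\<in>topspace X. h (t, x)) \<in> extensional (topspace X) \<and>
      continuous_map X Y (\<lambda>x\<in>topspace X. h (t, x))"
    by simp
next
  fix K U assume K: "compactin X K" and U: "openin Y U"
  have sub: "K \<subseteq> topspace X"
    using K by (rule compactin_subset_topspace)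
  let ?P = "prod_topology T (subtopology X K)"
  have hK: "continuous_map ?P Y h"
    using h by (simp add: prod_topology_subtopology continuous_map_from_subtopology)
  have "closedin ?P {z \<in> topspace ?P. h z \<in> topspace Y - U}"
    using U by (intro closedin_continuous_map_preimage[OF hK]) blast
  then have "closedin T (fst ` {z \<in> topspace ?P. h z \<in> topspace Y - U})"
    using closed_map_fst[of "subtopology X K" T] K by (simp add: closed_map_def compact_space_subtopology)
  then have "openin T (topspace T - fst ` {z \<in> topspace ?P. h z \<in> topspace Y - U})"
    by blast
  moreover have "h (t, x) \<in> topspace Y" if "t \<in> topspace T" "x \<in> K" for t x
    using continuous_map_image_subset_topspace[OF h] that sub by auto
  then have "topspace T - fst ` {z \<in> topspace ?P. h z \<in> topspace Y - U} =
      {t \<in> topspace T. (\<lambda>x\<in>topspace X. h (t, x)) ` K \<subseteq> U}"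
    using sub by (force simp: image_iff)
  ultimately show "openin T {t \<in> topspace T. (\<lambda>x\<in>topspace X. h (t, x)) ` K \<subseteq> U}"
    by simp
qed

text \<open>The cube is path connected and has a boundary point when \<open>n \<ge> 1\<close>. Passing to the path
  component therefore does not change \<open>\<pi>\<^sub>n\<close>, and cubes can be taken in the whole mapping space, where different
  base maps are treated alike.\<close>

lemma cube_maps_into_path_component:
  assumes n: "n \<ge> 1"
  shows "pair_maps (cube n) (cube_boundary n) (subtopology M (path_component_of_set M p)) p =
    pair_maps (cube n) (cube_boundary n) M p"
proof -
  have "\<alpha> ` topspace (cube n) \<subseteq> path_component_of_set M p"
    if \<alpha>: "\<alpha> \<in> pair_maps (cube n) (cube_boundary n) M p" for \<alpha>
  proof (rule path_component_of_maximal)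
    have "path_connected_space (cube n)"
      using path_connectedin_def[of euclidean "{0..1::real}"]
      by (simp add: cube_def path_connected_space_product_topology)
    then show "path_connectedin M (\<alpha> ` topspace (cube n))"
      using \<alpha> by (intro path_connectedin_continuous_map_image[of "cube n"])
        (auto simp: pair_maps_def path_connectedin_topspace)
    let ?z = "\<lambda>i\<in>{..<n}. 0::real"
    have "?z \<in> cube_boundary n"
      using n by (auto simp: cube_boundary_def topspace_cube intro!: exI[of _ 0])
    then show "p \<in> \<alpha> ` topspace (cube n)"
      using \<alpha> cube_boundary_subset[of n] by (force simp: pair_maps_def)
  qed
  then show ?thesis
    by (auto simp: pair_maps_def continuous_map_in_subtopology)
qed


section \<open>Evaluation subgroups\<close>

lemma evaluation_subgroup_eq:
  assumes n: "n \<ge> 1" and x0: "x0 \<in> topspace X" and f: "f \<in> based_maps X x0 Y y0"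
  shows "evaluation_subgroup n Y X x0 f =
    (\<lambda>\<alpha>. cube_class n Y y0 (compose (topspace (cube n)) (\<lambda>g. g x0) \<alpha>)) `
      pair_maps (cube n) (cube_boundary n) (mapping_space X Y) f"
proof -
  let ?C = "mapping_component X Y f" and ?I = "topspace (cube n)" and ?e = "\<lambda>g. g x0"
  have fx0: "f x0 = y0"
    using f by (auto simp: pair_maps_def)
  have ev: "continuous_map ?C Y ?e"
    unfolding mapping_component_def
    by (intro continuous_map_from_subtopology continuous_map_evaluation x0)
  have "induced_map n f Y ?e (cube_class n ?C f \<alpha>) = cube_class n Y y0 (compose ?I ?e \<alpha>)"
    if "\<alpha> \<in> pair_maps (cube n) (cube_boundary n) ?C f" for \<alpha>
  proof -
    have "cube_class n Y y0 (compose ?I ?e \<beta>) = cube_class n Y y0 (compose ?I ?e \<alpha>)"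
      if "\<beta> \<in> cube_class n ?C f \<alpha>" for \<beta>
    proof -
      have "(\<alpha>, \<beta>) \<in> pair_homotopy (cube n) (cube_boundary n) ?C f"
        using that by (simp add: pair_class_def)
      from compose_pair_homotopic[OF pair_homotopyD(3)[OF this] ev _ cube_boundary_subset] fx0
      show ?thesis
        by (intro pair_class_eqI[symmetric]) simp
    qed
    then have "(\<Union>\<beta>\<in>cube_class n ?C f \<alpha>. cube_class n Y y0 (compose ?I ?e \<beta>)) =
        cube_class n Y y0 (compose ?I ?e \<alpha>)"
      using pair_class_self[OF that] by blast
    then show ?thesis
      by (simp add: induced_map_def fx0)
  qed
  then show ?thesis
    unfolding evaluation_subgroup_def homotopy_group_def
    by (simp add: pair_classes_eq_image image_image mapping_component_def
        cube_maps_into_path_component[OF n])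
qed

text \<open>Evaluation is applied pointwise, so it commutes with concatenation and reversal already for
  cubes, and not only for their classes.\<close>

lemma subgroup_evaluation_subgroup:
  assumes n: "n \<ge> 1" and x0: "x0 \<in> topspace X" and y0: "y0 \<in> topspace Y"
    and f: "f \<in> based_maps X x0 Y y0"
  shows "subgroup (evaluation_subgroup n Y X x0 f) (homotopy_group n Y y0)"
proof -
  let ?G = "homotopy_group n Y y0" and ?M = "mapping_space X Y"
  let ?P = "pair_maps (cube n) (cube_boundary n) ?M f"
  let ?I = "topspace (cube n)" and ?e = "\<lambda>g. g x0"
  let ?c = "\<lambda>\<alpha>. cube_class n Y y0 (compose ?I ?e \<alpha>)"
  interpret G: group ?G
    by (rule group_homotopy_group[OF n y0])
  have fx0: "f x0 = y0"
    using f by (auto simp: pair_maps_def)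
  have fM: "f \<in> topspace ?M"
    using f by (simp add: topspace_mapping_space pair_maps_def)
  have mem: "compose ?I ?e \<alpha> \<in> pair_maps (cube n) (cube_boundary n) Y y0" if "\<alpha> \<in> ?P" for \<alpha>
    by (rule compose_pair_maps[where e = ?e,
          OF that continuous_map_evaluation[OF x0] fx0 cube_boundary_subset])
  have carr: "?c \<alpha> \<in> carrier ?G" if "\<alpha> \<in> ?P" for \<alpha>
    using mem[OF that] by (simp add: homotopy_group_def pair_classes_eq_image)
  have inv: "inv\<^bsub>?G\<^esub> (?c \<alpha>) = ?c (cube_reverse n \<alpha>)" if \<alpha>: "\<alpha> \<in> ?P" for \<alpha>
  proof -
    have r: "cube_reverse n \<alpha> \<in> ?P"
      by (rule cube_reverse_pair_maps[OF n \<alpha>])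
    have "x(0 := 1 - x 0) \<in> ?I" if "x \<in> ?I" for x
      using cube_coord[OF that, of 0] n by (intro update_coord0_in_cube that) auto
    then have "compose ?I ?e (cube_reverse n \<alpha>) = cube_reverse n (compose ?I ?e \<alpha>)"
      by (auto simp: compose_def cube_reverse_def fun_eq_iff)
    then have "?c (cube_reverse n \<alpha>) \<otimes>\<^bsub>?G\<^esub> ?c \<alpha> = \<one>\<^bsub>?G\<^esub>"
      using homotopy_group_mult[OF n mem[OF r] mem[OF \<alpha>]]
        pair_class_eqI[OF cube_concat_reverse[OF n mem[OF \<alpha>]]]
      by (simp add: homotopy_group_def)
    then show ?thesis
      by (rule G.inv_equality) (use carr r \<alpha> in auto)
  qed
  have "subgroup (?c ` ?P) ?G"
  proof (rule G.subgroupI)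
    show "?c ` ?P \<subseteq> carrier ?G"
      using carr by blast
    show "?c ` ?P \<noteq> {}"
      using const_cube_map[OF fM, of n] by blast
    show "inv\<^bsub>?G\<^esub> a \<in> ?c ` ?P" if a: "a \<in> ?c ` ?P" for a
    proof -
      obtain \<alpha> where \<alpha>: "\<alpha> \<in> ?P" "a = ?c \<alpha>"
        using a by blast
      show ?thesis
        unfolding \<alpha>(2)
        by (rule image_eqI[OF _ cube_reverse_pair_maps[OF n \<alpha>(1)]]) (rule inv[OF \<alpha>(1)])
    qed
    show "a \<otimes>\<^bsub>?G\<^esub> b \<in> ?c ` ?P" if ab: "a \<in> ?c ` ?P" "b \<in> ?c ` ?P" for a b
    proof -
      obtain \<alpha> \<beta> where \<alpha>: "\<alpha> \<in> ?P" "a = ?c \<alpha>" and \<beta>: "\<beta> \<in> ?P" "b = ?c \<beta>"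
        using ab by blast
      have "x(0 := 2 * x 0) \<in> ?I" if "x \<in> ?I" "x 0 \<le> 1/2" for x
        using that cube_coord[OF that(1), of 0] n by (intro update_coord0_in_cube) auto
      moreover have "x(0 := 2 * x 0 - 1) \<in> ?I" if "x \<in> ?I" "\<not> x 0 \<le> 1/2" for x
        using that cube_coord[OF that(1), of 0] n by (intro update_coord0_in_cube) auto
      ultimately have "cube_concat n (compose ?I ?e \<alpha>) (compose ?I ?e \<beta>) =
          compose ?I ?e (cube_concat n \<alpha> \<beta>)"
        by (auto simp: cube_concat_def compose_def fun_eq_iff)
      then have "a \<otimes>\<^bsub>?G\<^esub> b = ?c (cube_concat n \<alpha> \<beta>)"
        using homotopy_group_mult[OF n mem[OF \<alpha>(1)] mem[OF \<beta>(1)]] \<alpha>(2) \<beta>(2) by simp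
      then show ?thesis
        using cube_concat_pair_maps[OF n \<alpha>(1) \<beta>(1)] by blast
    qed
  qed
  then show ?thesis
    by (simp add: evaluation_subgroup_eq[OF n x0 f])
qed

text \<open>Precomposition with \<open>s\<close> is continuous on mapping spaces and, as \<open>s\<close> fixes \<open>x0\<close>, does not alter
  the value at \<open>x0\<close>. So the same element of \<open>\<pi>\<^sub>n(Y)\<close> is realized by a cube based at
  \<open>g \<circ> s\<close>.\<close>

lemma evaluation_subgroup_precompose:
  assumes n: "n \<ge> 1" and x0: "x0 \<in> topspace X"
    and g: "g \<in> based_maps X x0 Y y0" and s: "s \<in> based_maps X x0 X x0"
  shows "evaluation_subgroup n Y X x0 g \<subseteq> evaluation_subgroup n Y X x0 (compose (topspace X) g s)"
proof -
  let ?M = "mapping_space X Y" and ?I = "topspace (cube n)" and ?e = "\<lambda>g. g x0"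
  let ?s = "\<lambda>k. compose (topspace X) k s"
  have sc: "continuous_map X X s" and sx0: "s x0 = x0"
    using s by (auto simp: pair_maps_def)
  have gs: "?s g \<in> based_maps X x0 Y y0"
    by (rule based_compose[OF g s x0])
  show ?thesis
    unfolding evaluation_subgroup_eq[OF n x0 g]
  proof (rule image_subsetI)
    fix \<alpha> assume \<alpha>: "\<alpha> \<in> pair_maps (cube n) (cube_boundary n) ?M g"
    have "compose ?I ?s \<alpha> \<in> pair_maps (cube n) (cube_boundary n) ?M (?s g)"
      by (rule compose_pair_maps[OF \<alpha> continuous_map_precompose[OF sc] refl cube_boundary_subset])
    moreover have "compose ?I ?e (compose ?I ?s \<alpha>) = compose ?I ?e \<alpha>"
      using sx0 x0 by (auto simp: compose_def fun_eq_iff)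
    ultimately show "cube_class n Y y0 (compose ?I ?e \<alpha>) \<in> evaluation_subgroup n Y X x0 (?s g)"
      unfolding evaluation_subgroup_eq[OF n x0 gs] by (intro image_eqI) simp_all
  qed
qed

text \<open>The based homotopy is a path of maps from \<open>f\<close> to \<open>g\<close> whose values at \<open>x0\<close> stay at
  \<open>y0\<close>; the base point of a cube at \<open>g\<close> is moved along it to \<open>f\<close>.\<close>

lemma evaluation_subgroup_homotopic_subset:
  assumes n: "n \<ge> 1" and x0: "x0 \<in> topspace X"
    and fg: "(f, g) \<in> pair_homotopy X {x0} Y y0"
  shows "evaluation_subgroup n Y X x0 g \<subseteq> evaluation_subgroup n Y X x0 f"
proof -
  let ?M = "mapping_space X Y" and ?I = "topspace (cube n)" and ?e = "\<lambda>g. g x0"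
  note f = pair_homotopyD(1)[OF fg] and g = pair_homotopyD(2)[OF fg]
  obtain h where h: "continuous_map (prod_topology (top_of_set {0..1::real}) X) Y h"
    "\<And>x. h (0, x) = f x" "\<And>x. h (1, x) = g x"
    "\<And>t x. t \<in> {0..1} \<Longrightarrow> x \<in> {x0} \<Longrightarrow> h (t, x) = y0"
    using fg by (rule pair_homotopyE) blast
  define \<gamma> where "\<gamma> = (\<lambda>t. \<lambda>x\<in>topspace X. h (t, x))"
  have \<gamma>: "continuous_map (top_of_set {0..1}) ?M \<gamma>"
    unfolding \<gamma>_def by (rule continuous_map_curry_mapping_space[OF h(1)])
  have \<gamma>01: "\<gamma> 0 = f" "\<gamma> 1 = g"
    using f g by (simp_all add: \<gamma>_def h(2,3) pair_maps_def extensional_restrict)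
  have \<gamma>x0: "?e (\<gamma> t) = y0" if "t \<in> {0..1}" for t
    using h(4)[OF that] x0 by (simp add: \<gamma>_def)
  show ?thesis
    unfolding evaluation_subgroup_eq[OF n x0 g]
  proof (rule image_subsetI)
    fix \<alpha> assume \<alpha>: "\<alpha> \<in> pair_maps (cube n) (cube_boundary n) ?M g"
    have "\<alpha> \<in> pair_maps (cube n) (cube_boundary n) ?M (\<gamma> 1)"
      using \<alpha> \<gamma>01 by simp
    from base_point_change[where e = ?e and Y = Y and ?y0.0 = y0,
        OF n \<gamma> this continuous_map_evaluation[OF x0] \<gamma>x0]
    obtain \<alpha>' where \<alpha>': "\<alpha>' \<in> pair_maps (cube n) (cube_boundary n) ?M (\<gamma> 0)"
      and hom: "(compose ?I ?e \<alpha>', compose ?I ?e \<alpha>) \<in> pair_homotopy (cube n) (cube_boundary n) Y y0"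
      by (rule bexE)
    show "cube_class n Y y0 (compose ?I ?e \<alpha>) \<in> evaluation_subgroup n Y X x0 f"
      unfolding evaluation_subgroup_eq[OF n x0 f]
      by (rule image_eqI[OF _ \<alpha>'[unfolded \<gamma>01]]) (rule pair_class_eqI[OF hom, symmetric])
  qed
qed

text \<open>By definition \<open>[f] \<le>\<^sub>R [g]\<close> means that \<open>f\<close> is based homotopic to some \<open>g \<circ> s\<close>, so the two
  preceding inclusions compose.\<close>

lemma evaluation_subgroup_antimono:
  assumes n: "n \<ge> 1" and x0: "x0 \<in> topspace X"
    and f: "f \<in> based_maps X x0 Y y0" and g: "g \<in> based_maps X x0 Y y0"
    and le: "leR X x0 Y y0 (based_class X x0 Y y0 f) (based_class X x0 Y y0 g)"
  shows "evaluation_subgroup n Y X x0 g \<subseteq> evaluation_subgroup n Y X x0 f"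
proof -
  obtain s where s: "s \<in> based_maps X x0 X x0"
    "homotopic_with (\<lambda>h. h ` {x0} \<subseteq> {y0}) X Y f (compose (topspace X) g s)"
    using le leR_class_iff[OF f g x0] by blast
  then have "(f, compose (topspace X) g s) \<in> pair_homotopy X {x0} Y y0"
    using f based_compose[OF g s(1) x0] by (simp add: pair_homotopy_def)
  from evaluation_subgroup_homotopic_subset[OF n x0 this]
  show ?thesis
    using evaluation_subgroup_precompose[OF n x0 g s(1)] by blast
qed

text \<open>The inclusion for homotopic maps, applied to a homotopy and its reverse, shows that all representatives of
  a based class have the same evaluation subgroup, which makes \<open>the_elem\<close> in \<open>ev_class\<close>
  meaningful.\<close>

lemma ev_class_eq:
  assumes n: "n \<ge> 1" and x0: "x0 \<in> topspace X" and f: "f \<in> based_maps X x0 Y y0"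
  shows "ev_class n Y X x0 (based_class X x0 Y y0 f) = evaluation_subgroup n Y X x0 f"
proof -
  have "evaluation_subgroup n Y X x0 g = evaluation_subgroup n Y X x0 f"
    if "g \<in> based_class X x0 Y y0 f" for g
  proof -
    have "(f, g) \<in> pair_homotopy X {x0} Y y0"
      using that by (simp add: pair_class_def)
    then show ?thesis
      using evaluation_subgroup_homotopic_subset[OF n x0] pair_homotopy_sym by (metis subset_antisym)
  qed
  then have "evaluation_subgroup n Y X x0 ` based_class X x0 Y y0 f = {evaluation_subgroup n Y X x0 f}"
    using pair_class_self[OF f] by blast
  then show ?thesis
    by (simp add: ev_class_def)
qed

lemma ev_class_antimono:
  assumes n: "n \<ge> 1" and x0: "x0 \<in> topspace X" and le: "leR X x0 Y y0 a b"
  shows "ev_class n Y X x0 b \<subseteq> ev_class n Y X x0 a"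
proof -
  obtain f g where fg: "f \<in> based_maps X x0 Y y0" "a = based_class X x0 Y y0 f"
    "g \<in> based_maps X x0 Y y0" "b = based_class X x0 Y y0 g"
    using le by (meson based_classesE leR_def)
  then show ?thesis
    using evaluation_subgroup_antimono[OF n x0 fg(1,3)] le by (simp add: ev_class_eq[OF n x0])
qed

text \<open>Equivalent classes precede each other, so antitonicity makes \<open>ev_class\<close> constant on
  the class modulo \<open>simR\<close>.\<close>

lemma ev_classR_projR:
  assumes n: "n \<ge> 1" and x0: "x0 \<in> topspace X" and a: "a \<in> based_classes X x0 Y y0"
  shows "ev_classR n Y X x0 (projR X x0 Y y0 a) = ev_class n Y X x0 a"
proof -
  have "ev_class n Y X x0 b = ev_class n Y X x0 a" if "b \<in> projR X x0 Y y0 a" for b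
  proof -
    have "leR X x0 Y y0 a b" "leR X x0 Y y0 b a"
      using that by (simp_all add: projR_def simR_def)
    then show ?thesis
      using ev_class_antimono[OF n x0] by (metis subset_antisym)
  qed
  moreover have "a \<in> projR X x0 Y y0 a"
    using leR_refl[OF x0 a] by (simp add: projR_def simR_def)
  ultimately have "ev_class n Y X x0 ` projR X x0 Y y0 a = {ev_class n Y X x0 a}"
    by blast
  then show ?thesis
    by (simp add: ev_classR_def)
qed

theorem theorem4p14:
  fixes X :: "'a topology" and Y :: "'b topology" and x0 :: 'a and y0 :: 'b and n :: nat
  assumes "x0 \<in> topspace X" and "y0 \<in> topspace Y" and "n \<ge> 1"
  shows
    "(\<forall>f \<in> based_maps X x0 Y y0.
        ev_class n Y X x0 (based_class X x0 Y y0 f) = evaluation_subgroup n Y X x0 f \<and>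
        ev_classR n Y X x0 (projR X x0 Y y0 (based_class X x0 Y y0 f)) =
          evaluation_subgroup n Y X x0 f) \<and>
     (\<forall>f \<in> based_maps X x0 Y y0. \<forall>g \<in> based_maps X x0 Y y0.
        leR X x0 Y y0 (based_class X x0 Y y0 f) (based_class X x0 Y y0 g) \<longrightarrow>
        evaluation_subgroup n Y X x0 g \<subseteq> evaluation_subgroup n Y X x0 f \<and>
        ev_class n Y X x0 (based_class X x0 Y y0 g)
          \<subseteq> ev_class n Y X x0 (based_class X x0 Y y0 f)) \<and>
     ev_class n Y X x0 \<in> based_classes X x0 Y y0 \<rightarrow> Sub (homotopy_group n Y y0) \<and>
     monotone_on (based_classes X x0 Y y0) (leR X x0 Y y0)\<inverse>\<inverse> (\<subseteq>) (ev_class n Y X x0) \<and>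
     (\<forall>f \<in> based_maps X x0 Y y0. \<forall>g \<in> based_maps X x0 Y y0.
        leR' X x0 Y y0 (projR X x0 Y y0 (based_class X x0 Y y0 f))
                       (projR X x0 Y y0 (based_class X x0 Y y0 g)) \<longrightarrow>
        evaluation_subgroup n Y X x0 g \<subseteq> evaluation_subgroup n Y X x0 f \<and>
        ev_classR n Y X x0 (projR X x0 Y y0 (based_class X x0 Y y0 g))
          \<subseteq> ev_classR n Y X x0 (projR X x0 Y y0 (based_class X x0 Y y0 f))) \<and>
     ev_classR n Y X x0 \<in> based_classesR X x0 Y y0 \<rightarrow> Sub (homotopy_group n Y y0) \<and>
     monotone_on (based_classesR X x0 Y y0) (leR' X x0 Y y0)\<inverse>\<inverse> (\<subseteq>) (ev_classR n Y X x0) \<and>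
     (\<forall>a \<in> based_classes X x0 Y y0.
        (ev_classR n Y X x0 \<circ> projR X x0 Y y0) a = ev_class n Y X x0 a)"
proof -
  let ?cl = "based_class X x0 Y y0" and ?pr = "projR X x0 Y y0"
  let ?ev = "ev_class n Y X x0" and ?evR = "ev_classR n Y X x0"
  note ev = ev_class_eq[OF assms(3,1)]
  have evR: "?evR (?pr a) = ?ev a" if "a \<in> based_classes X x0 Y y0" for a
    by (rule ev_classR_projR[OF assms(3,1) that])
  note anti = ev_class_antimono[OF assms(3,1)]
  have cl: "?cl f \<in> based_classes X x0 Y y0" if "f \<in> based_maps X x0 Y y0" for f
    using that by (simp add: pair_classes_eq_image)
  have sub: "?ev a \<in> Sub (homotopy_group n Y y0)" if "a \<in> based_classes X x0 Y y0" for a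
    using that subgroup_evaluation_subgroup[OF assms(3,1,2)]
    by (auto simp: Sub_def ev elim!: based_classesE)
  have antiR: "?evR (?pr b) \<subseteq> ?evR (?pr a)"
    if "leR' X x0 Y y0 (?pr a) (?pr b)" "a \<in> based_classes X x0 Y y0" "b \<in> based_classes X x0 Y y0"
    for a b
  proof -
    have "leR X x0 Y y0 a b"
      using that by (simp add: leR'_projR_iff[OF assms(1)])
    from anti[OF this] show ?thesis
      using that(2,3) by (simp add: evR)
  qed
  have clR: "based_classesR X x0 Y y0 = ?pr ` based_classes X x0 Y y0"
    by (auto simp: based_classesR_def projR_def quotient_def)
  have 1: "?ev (?cl f) = evaluation_subgroup n Y X x0 f \<and>
      ?evR (?pr (?cl f)) = evaluation_subgroup n Y X x0 f" if "f \<in> based_maps X x0 Y y0" for f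
    using ev[OF that] evR[OF cl[OF that]] by simp
  have 2: "evaluation_subgroup n Y X x0 g \<subseteq> evaluation_subgroup n Y X x0 f \<and> ?ev (?cl g) \<subseteq> ?ev (?cl f)"
    if "f \<in> based_maps X x0 Y y0" "g \<in> based_maps X x0 Y y0" "leR X x0 Y y0 (?cl f) (?cl g)" for f g
    using anti[OF that(3)] that(1,2) by (simp add: ev)
  have 3: "evaluation_subgroup n Y X x0 g \<subseteq> evaluation_subgroup n Y X x0 f \<and>
      ?evR (?pr (?cl g)) \<subseteq> ?evR (?pr (?cl f))"
    if "f \<in> based_maps X x0 Y y0" "g \<in> based_maps X x0 Y y0"
      "leR' X x0 Y y0 (?pr (?cl f)) (?pr (?cl g))" for f g
    using antiR[OF that(3) cl[OF that(1)] cl[OF that(2)]] 1[OF that(1)] 1[OF that(2)] by simp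
  have 4: "?ev \<in> based_classes X x0 Y y0 \<rightarrow> Sub (homotopy_group n Y y0)"
    "?evR \<in> based_classesR X x0 Y y0 \<rightarrow> Sub (homotopy_group n Y y0)"
    using sub by (auto simp: clR evR)
  have 5: "monotone_on (based_classes X x0 Y y0) (leR X x0 Y y0)\<inverse>\<inverse> (\<subseteq>) ?ev"
    "monotone_on (based_classesR X x0 Y y0) (leR' X x0 Y y0)\<inverse>\<inverse> (\<subseteq>) ?evR"
    by (rule monotone_onI, rule anti, simp) (unfold clR, rule monotone_onI, use antiR in blast)
  show ?thesis
    using 1 2 3 4 5 evR by simp
qed

end
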